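(* Let $\Gamma\vdash e\colon\tau$ be a derivable typing judgment of the formalism $\mathit{RS}^-_1$ (described in the context) in which $\tau$ and every type $\Gamma(x)$, $x\in\mathrm{dom}(\Gamma)$, are ground types. Then one can effectively find a normal polynomial $p$ such that for every environment $\theta$ for the judgment, $$\lVert e\rVert\theta \;\le\; p(\theta) + \lVert y_1,\dots,y_n\rVert\theta,$$ where $\{y_1,\dots,y_n\}=\mathbf{sfv}(e)$. (Written compactly: $\lVert e\rVert\le p+\lVert\mathbf{sfv}(e)\rVert$.)
   Context: The formalism $\mathit{RS}^-_1$. A program begins with declarations $\mathbf{data}\ \tau=\mu t.\sigma$, where $\sigma$ is a ground type (built with $+$ and $\times$ from $t$, $\mathbf{unit}$ and previously declared data types); $F_\tau t=\sigma$ is the polynomial signature functor of $\tau$. Normal base types are $\mathbf{unit}$ and declared data types; normal ground types are their closure under $+,\times$; in a declaration $\sigma$ must be normal. Each declaration also introduces a safe copy $\underline{\tau}$; set $\underline{\mathbf{unit}}=\mathbf{unit}$, $\underline{\sigma_1\times\sigma_2}=\underline{\sigma_1}\times\underline{\sigma_2}$, $\underline{\sigma_1+\sigma_2}=\underline{\sigma_1}+\underline{\sigma_2}$; safe ground types are those of the form $\underline{\sigma}$ ($\mathbf{unit}$ is both normal and safe). Types are simple types over these base types with $+,\times,\to$; ground types are $\to$-free types. Terms: variables, application, $\lambda$-abstraction, $()$, pairs, projections $\pi_i$, injections $\iota_i$, case, constructors $c_\tau\colon F_\tau\tau\to\tau$, destructors $d_\tau\colon\tau\to F_\tau\tau$,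 safe constructors/destructors $\underline{c}_\tau\colon\underline{F_\tau\tau}\to\underline\tau$, $\underline{d}_\tau\colon\underline\tau\to\underline{F_\tau\tau}$, and recursors $\mathrm{fold}^s_\tau f\,e$. Typing is the standard simply-typed one, except: the pair and injection rules require the component types $\sigma_1,\sigma_2$ to be both normal ground or both safe ground types; the rule for $\mathrm{fold}^s_\tau$ derives $\Gamma\vdash \mathrm{fold}^s_\tau f\,e\colon\sigma$ from $\Gamma\vdash f\colon F_\tau\sigma\to\sigma$ and $\Gamma\vdash e\colon\tau$ only when $\tau$ is normal and $\sigma$ is safe; and a "lower" rule derives $\Gamma\vdash e\colon\tau$ from $\Gamma\vdash e\colon\underline{\tau}$ when $\mathbf{sfv}(e)=\emptyset$. Here $\mathbf{sfv}(e)=\{x\in\mathrm{fv}(e): \Gamma(x)\text{ is a safe type}\}$. Semantics: call-by-value evaluation of closures $e\theta$ (with $\theta$ an environment mapping variables of $\Gamma$, including $\mathrm{fv}(e)$, to values of the right types), satisfying $(\mathrm{fold}_\tau g)\circ c_\tau=g\circ F_\tau(\mathrm{fold}_\tau g)$. Data are represented as dags of cons-cells: each constructor (data, pair or injection) invocation allocates a fresh cell holding pointers to its arguments' values and returns a pointer to it; folds are memoized over the dag. Apparent size: for ground-type closures, $\lVert e_0,\dots,e_k\rVert\theta$ is the number of data cons-cells (cells allocated by data-type constructors, not pair/injection cells) in the union of the representations of the values of $e_0\theta,\dots,e_k\theta$, shared cells counted once. A normal polynomial is a polynomial with natural-number coefficients in the quantities $\lVert x\rVert$ for $x$ with $\Gamma(x)$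 normal; $p(\theta)$ denotes its value with $\lVert x\rVert:=\lVert x\rVert\theta$.
   Formalization: In sfv(e), so also in the lower rule, function types with safe result and ground types mixing normal and safe parts count as safe (otherwise a fold over lists reaches size 2^|x|); mixed product and sum types have no values in environments, as in the pair and injection rules. *)

theory Defs
  imports Main
begin

section \<open>Types\<close>

text \<open>
  A program declares finitely many data types \<open>data \<tau> = \<mu>t. \<sigma>\<close>.  The \<open>i\<close>-th declared type is
  named by its index \<open>i\<close>, and its declaration is the body \<open>\<sigma>\<close> of the signature functor, in which
  \<open>Rec\<close> stands for the bound variable \<open>t\<close>.
\<close>

datatype sig = Rec | SigUnit | SigData nat | SigSum sig sig | SigProd sig sig

type_synonym decls = "sig list"

fun sig_data :: "sig \<Rightarrow> nat set" where
  "sig_data Rec = {}"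
| "sig_data SigUnit = {}"
| "sig_data (SigData j) = {j}"
| "sig_data (SigSum s t) = sig_data s \<union> sig_data t"
| "sig_data (SigProd s t) = sig_data s \<union> sig_data t"

definition wf_decls :: "decls \<Rightarrow> bool" where
  "wf_decls D \<longleftrightarrow> (\<forall>i<length D. \<forall>j\<in>sig_data (D ! i). j < i)"

datatype ty = Unit | Data nat | SafeData nat | Sum ty ty | Prod ty ty | Arrow ty ty

fun wf_ty :: "decls \<Rightarrow> ty \<Rightarrow> bool" where
  "wf_ty D Unit \<longleftrightarrow> True"
| "wf_ty D (Data i) \<longleftrightarrow> i < length D"
| "wf_ty D (SafeData i) \<longleftrightarrow> i < length D"
| "wf_ty D (Sum A B) \<longleftrightarrow> wf_ty D A \<and> wf_ty D B"
| "wf_ty D (Prod A B) \<longleftrightarrow> wf_ty D A \<and> wf_ty D B"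
| "wf_ty D (Arrow A B) \<longleftrightarrow> wf_ty D A \<and> wf_ty D B"

fun functor_ty :: "sig \<Rightarrow> ty \<Rightarrow> ty" where
  "functor_ty Rec A = A"
| "functor_ty SigUnit A = Unit"
| "functor_ty (SigData j) A = Data j"
| "functor_ty (SigSum s t) A = Sum (functor_ty s A) (functor_ty t A)"
| "functor_ty (SigProd s t) A = Prod (functor_ty s A) (functor_ty t A)"

fun ground :: "ty \<Rightarrow> bool" where
  "ground (Sum A B) \<longleftrightarrow> ground A \<and> ground B"
| "ground (Prod A B) \<longleftrightarrow> ground A \<and> ground B"
| "ground (Arrow A B) \<longleftrightarrow> False"
| "ground _ \<longleftrightarrow> True"

fun normal_ground :: "ty \<Rightarrow> bool" where
  "normal_ground Unit \<longleftrightarrow> True"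
| "normal_ground (Data i) \<longleftrightarrow> True"
| "normal_ground (SafeData i) \<longleftrightarrow> False"
| "normal_ground (Sum A B) \<longleftrightarrow> normal_ground A \<and> normal_ground B"
| "normal_ground (Prod A B) \<longleftrightarrow> normal_ground A \<and> normal_ground B"
| "normal_ground (Arrow A B) \<longleftrightarrow> False"

text \<open>The underlining operation; only its values on normal ground types matter.\<close>

fun under :: "ty \<Rightarrow> ty" where
  "under (Data i) = SafeData i"
| "under (Sum A B) = Sum (under A) (under B)"
| "under (Prod A B) = Prod (under A) (under B)"
| "under A = A"

definition safe_ground :: "ty \<Rightarrow> bool" where
  "safe_ground A \<longleftrightarrow> (\<exists>B. normal_ground B \<and> A = under B)"

definition same_kind :: "ty \<Rightarrow> ty \<Rightarrow> bool" where
  "same_kind A B \<longleftrightarrow> (normal_ground A \<and> normal_ground B) \<or> (safe_ground A \<and> safe_ground B)"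

fun yields_safe :: "ty \<Rightarrow> bool" where
  "yields_safe Unit \<longleftrightarrow> False"
| "yields_safe (Data i) \<longleftrightarrow> False"
| "yields_safe (SafeData i) \<longleftrightarrow> True"
| "yields_safe (Sum A B) \<longleftrightarrow> yields_safe A \<or> yields_safe B"
| "yields_safe (Prod A B) \<longleftrightarrow> yields_safe A \<or> yields_safe B"
| "yields_safe (Arrow A B) \<longleftrightarrow> yields_safe B"

text \<open>
  On types that are normal ground or safe ground, \<open>safe_type\<close> is \<open>safe_ground\<close>.  The second disjunct
  extends the notion to the remaining types of variables: function types (through their result
  type) and ground types with both normal and safe parts, such as the argument type
  \<open>functor_ty s A\<close> of a recursion step.  Without it the lower rule would turn safe data into normal
  data, as in \<open>(\<lambda>f. f ()) (\<lambda>u. y)\<close> with \<open>y\<close> safe and \<open>f ()\<close> lowered, or when the result of a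
  recursive call is selected from the argument of a recursion step over lists.
\<close>

definition safe_type :: "ty \<Rightarrow> bool" where
  "safe_type A \<longleftrightarrow> safe_ground A \<or> yields_safe A"


section \<open>Terms and typing\<close>

datatype tm =
    Var nat
  | App tm tm
  | Lam nat tm
  | Triv
  | Pair tm tm
  | Fst tm
  | Snd tm
  | Inl tm
  | Inr tm
  | Case tm nat tm nat tm
  | Con nat
  | Des nat
  | SafeCon nat
  | SafeDes nat
  | Fold nat tm tm

fun fv :: "tm \<Rightarrow> nat set" where
  "fv (Var x) = {x}"
| "fv (App e f) = fv e \<union> fv f"
| "fv (Lam x e) = fv e - {x}"
| "fv Triv = {}"
| "fv (Pair e f) = fv e \<union> fv f"
| "fv (Fst e) = fv e"
| "fv (Snd e) = fv e"
| "fv (Inl e) = fv e"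
| "fv (Inr e) = fv e"
| "fv (Case e x f y g) = fv e \<union> (fv f - {x}) \<union> (fv g - {y})"
| "fv (Con i) = {}"
| "fv (Des i) = {}"
| "fv (SafeCon i) = {}"
| "fv (SafeDes i) = {}"
| "fv (Fold i f e) = fv f \<union> fv e"

text \<open>Typing contexts and environments are association lists; earlier entries shadow later ones.\<close>

type_synonym ctx = "(nat \<times> ty) list"

definition sfv :: "ctx \<Rightarrow> tm \<Rightarrow> nat set" where
  "sfv \<Gamma> e = {x \<in> fv e. \<exists>A. map_of \<Gamma> x = Some A \<and> safe_type A}"

inductive typing :: "decls \<Rightarrow> ctx \<Rightarrow> tm \<Rightarrow> ty \<Rightarrow> bool" for D :: decls where
  t_var: "map_of \<Gamma> x = Some A \<Longrightarrow> typing D \<Gamma> (Var x) A"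
| t_app: "typing D \<Gamma> e (Arrow A B) \<Longrightarrow> typing D \<Gamma> f A \<Longrightarrow> typing D \<Gamma> (App e f) B"
| t_lam: "wf_ty D A \<Longrightarrow> typing D ((x, A) # \<Gamma>) e B \<Longrightarrow> typing D \<Gamma> (Lam x e) (Arrow A B)"
| t_triv: "typing D \<Gamma> Triv Unit"
| t_pair: "typing D \<Gamma> e A \<Longrightarrow> typing D \<Gamma> f B \<Longrightarrow> same_kind A B \<Longrightarrow>
    typing D \<Gamma> (Pair e f) (Prod A B)"
| t_fst: "typing D \<Gamma> e (Prod A B) \<Longrightarrow> typing D \<Gamma> (Fst e) A"
| t_snd: "typing D \<Gamma> e (Prod A B) \<Longrightarrow> typing D \<Gamma> (Snd e) B"
| t_inl: "typing D \<Gamma> e A \<Longrightarrow> wf_ty D B \<Longrightarrow> same_kind A B \<Longrightarrow> typing D \<Gamma> (Inl e) (Sum A B)"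
| t_inr: "typing D \<Gamma> e B \<Longrightarrow> wf_ty D A \<Longrightarrow> same_kind A B \<Longrightarrow> typing D \<Gamma> (Inr e) (Sum A B)"
| t_case: "typing D \<Gamma> e (Sum A B) \<Longrightarrow> typing D ((x, A) # \<Gamma>) f C \<Longrightarrow>
    typing D ((y, B) # \<Gamma>) g C \<Longrightarrow> typing D \<Gamma> (Case e x f y g) C"
| t_con: "i < length D \<Longrightarrow>
    typing D \<Gamma> (Con i) (Arrow (functor_ty (D ! i) (Data i)) (Data i))"
| t_des: "i < length D \<Longrightarrow>
    typing D \<Gamma> (Des i) (Arrow (Data i) (functor_ty (D ! i) (Data i)))"
| t_safe_con: "i < length D \<Longrightarrow>
    typing D \<Gamma> (SafeCon i) (Arrow (under (functor_ty (D ! i) (Data i))) (SafeData i))"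
| t_safe_des: "i < length D \<Longrightarrow>
    typing D \<Gamma> (SafeDes i) (Arrow (SafeData i) (under (functor_ty (D ! i) (Data i))))"
| t_fold: "i < length D \<Longrightarrow> safe_ground A \<Longrightarrow>
    typing D \<Gamma> f (Arrow (functor_ty (D ! i) A) A) \<Longrightarrow> typing D \<Gamma> e (Data i) \<Longrightarrow>
    typing D \<Gamma> (Fold i f e) A"
| t_lower: "typing D \<Gamma> e (under A) \<Longrightarrow> normal_ground A \<Longrightarrow> sfv \<Gamma> e = {} \<Longrightarrow> typing D \<Gamma> e A"

definition wf_ctx :: "decls \<Rightarrow> ctx \<Rightarrow> bool" where
  "wf_ctx D \<Gamma> \<longleftrightarrow> (\<forall>x A. map_of \<Gamma> x = Some A \<longrightarrow> wf_ty D A)"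

definition ground_ctx :: "ctx \<Rightarrow> bool" where
  "ground_ctx \<Gamma> \<longleftrightarrow> (\<forall>x A. map_of \<Gamma> x = Some A \<longrightarrow> ground A)"


section \<open>Call-by-value evaluation with cons-cells\<close>

text \<open>
  A heap is the list of the cells allocated so far, and a pointer is a position in it.  Normal and
  safe constructors build the same cells, so lowering does not change a value.
\<close>

datatype val = VTriv | Ptr nat | Clo nat tm "(nat \<times> val) list" | VCon nat | VDes nat

datatype cell = DataCell nat val | PairCell val val | InlCell val | InrCell val

type_synonym env = "(nat \<times> val) list"
type_synonym heap = "cell list"

definition cell_at :: "heap \<Rightarrow> nat \<Rightarrow> cell \<Rightarrow> bool" where
  "cell_at h l c \<longleftrightarrow> l < length h \<and> h ! l = c"

text \<open>
  \<open>fold_eval D g i M h v r M' h'\<close>: starting with memo table \<open>M\<close>, which records the results for the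
  cells already visited, folding the value \<open>g\<close> over the value \<open>v\<close> of the \<open>i\<close>-th data type gives \<open>r\<close>
  and the memo table \<open>M'\<close>.  \<open>map_eval D g i s M h v r M' h'\<close> is the action on \<open>v\<close> of the functor \<open>s\<close>
  on this fold.
\<close>

inductive
  eval :: "decls \<Rightarrow> heap \<Rightarrow> env \<Rightarrow> tm \<Rightarrow> val \<Rightarrow> heap \<Rightarrow> bool" and
  app_eval :: "decls \<Rightarrow> heap \<Rightarrow> val \<Rightarrow> val \<Rightarrow> val \<Rightarrow> heap \<Rightarrow> bool" and
  fold_eval :: "decls \<Rightarrow> val \<Rightarrow> nat \<Rightarrow> (nat \<rightharpoonup> val) \<Rightarrow> heap \<Rightarrow> val \<Rightarrow>
    val \<Rightarrow> (nat \<rightharpoonup> val) \<Rightarrow> heap \<Rightarrow> bool" and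
  map_eval :: "decls \<Rightarrow> val \<Rightarrow> nat \<Rightarrow> sig \<Rightarrow> (nat \<rightharpoonup> val) \<Rightarrow> heap \<Rightarrow> val \<Rightarrow>
    val \<Rightarrow> (nat \<rightharpoonup> val) \<Rightarrow> heap \<Rightarrow> bool"
  for D :: decls where
  e_var: "map_of \<theta> x = Some v \<Longrightarrow> eval D h \<theta> (Var x) v h"
| e_app: "eval D h \<theta> e u h1 \<Longrightarrow> eval D h1 \<theta> f v h2 \<Longrightarrow> app_eval D h2 u v r h3 \<Longrightarrow>
    eval D h \<theta> (App e f) r h3"
| e_lam: "eval D h \<theta> (Lam x e) (Clo x e \<theta>) h"
| e_triv: "eval D h \<theta> Triv VTriv h"
| e_pair: "eval D h \<theta> e u h1 \<Longrightarrow> eval D h1 \<theta> f v h2 \<Longrightarrow>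
    eval D h \<theta> (Pair e f) (Ptr (length h2)) (h2 @ [PairCell u v])"
| e_fst: "eval D h \<theta> e (Ptr l) h1 \<Longrightarrow> cell_at h1 l (PairCell u v) \<Longrightarrow> eval D h \<theta> (Fst e) u h1"
| e_snd: "eval D h \<theta> e (Ptr l) h1 \<Longrightarrow> cell_at h1 l (PairCell u v) \<Longrightarrow> eval D h \<theta> (Snd e) v h1"
| e_inl: "eval D h \<theta> e v h1 \<Longrightarrow> eval D h \<theta> (Inl e) (Ptr (length h1)) (h1 @ [InlCell v])"
| e_inr: "eval D h \<theta> e v h1 \<Longrightarrow> eval D h \<theta> (Inr e) (Ptr (length h1)) (h1 @ [InrCell v])"
| e_case_inl: "eval D h \<theta> e (Ptr l) h1 \<Longrightarrow> cell_at h1 l (InlCell v) \<Longrightarrow>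
    eval D h1 ((x, v) # \<theta>) f r h2 \<Longrightarrow> eval D h \<theta> (Case e x f y g) r h2"
| e_case_inr: "eval D h \<theta> e (Ptr l) h1 \<Longrightarrow> cell_at h1 l (InrCell v) \<Longrightarrow>
    eval D h1 ((y, v) # \<theta>) g r h2 \<Longrightarrow> eval D h \<theta> (Case e x f y g) r h2"
| e_con: "eval D h \<theta> (Con i) (VCon i) h"
| e_des: "eval D h \<theta> (Des i) (VDes i) h"
| e_safe_con: "eval D h \<theta> (SafeCon i) (VCon i) h"
| e_safe_des: "eval D h \<theta> (SafeDes i) (VDes i) h"
| e_fold: "eval D h \<theta> f g h1 \<Longrightarrow> eval D h1 \<theta> e v h2 \<Longrightarrow>
    fold_eval D g i Map.empty h2 v r M h3 \<Longrightarrow> eval D h \<theta> (Fold i f e) r h3"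
| a_clo: "eval D h ((x, v) # \<theta>) e r h1 \<Longrightarrow> app_eval D h (Clo x e \<theta>) v r h1"
| a_con: "app_eval D h (VCon i) v (Ptr (length h)) (h @ [DataCell i v])"
| a_des: "cell_at h l (DataCell i v) \<Longrightarrow> app_eval D h (VDes i) (Ptr l) v h"
| f_memo: "M l = Some r \<Longrightarrow> fold_eval D g i M h (Ptr l) r M h"
| f_step: "M l = None \<Longrightarrow> cell_at h l (DataCell i v) \<Longrightarrow>
    map_eval D g i (D ! i) M h v w M1 h1 \<Longrightarrow> app_eval D h1 g w r h2 \<Longrightarrow>
    fold_eval D g i M h (Ptr l) r (M1(l \<mapsto> r)) h2"
| m_rec: "fold_eval D g i M h v r M1 h1 \<Longrightarrow> map_eval D g i Rec M h v r M1 h1"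
| m_unit: "map_eval D g i SigUnit M h VTriv VTriv M h"
| m_data: "map_eval D g i (SigData j) M h v v M h"
| m_inl: "cell_at h l (InlCell v) \<Longrightarrow> map_eval D g i s M h v w M1 h1 \<Longrightarrow>
    map_eval D g i (SigSum s t) M h (Ptr l) (Ptr (length h1)) M1 (h1 @ [InlCell w])"
| m_inr: "cell_at h l (InrCell v) \<Longrightarrow> map_eval D g i t M h v w M1 h1 \<Longrightarrow>
    map_eval D g i (SigSum s t) M h (Ptr l) (Ptr (length h1)) M1 (h1 @ [InrCell w])"
| m_prod: "cell_at h l (PairCell u v) \<Longrightarrow> map_eval D g i s M h u u' M1 h1 \<Longrightarrow>
    map_eval D g i t M1 h1 v v' M2 h2 \<Longrightarrow>
    map_eval D g i (SigProd s t) M h (Ptr l) (Ptr (length h2)) M2 (h2 @ [PairCell u' v'])"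

text \<open>
  Values of ground types.  As in the typing rules, pairs and injections have components of the same
  kind, so a product or sum with both normal and safe parts has no values in this sense; such
  structures occur only as intermediate arguments of recursion steps.
\<close>

inductive val_ty :: "decls \<Rightarrow> heap \<Rightarrow> val \<Rightarrow> ty \<Rightarrow> bool" for D :: decls and h :: heap where
  v_triv: "val_ty D h VTriv Unit"
| v_data: "cell_at h l (DataCell i v) \<Longrightarrow> i < length D \<Longrightarrow>
    val_ty D h v (functor_ty (D ! i) (Data i)) \<Longrightarrow> val_ty D h (Ptr l) (Data i)"
| v_safe_data: "cell_at h l (DataCell i v) \<Longrightarrow> i < length D \<Longrightarrow>
    val_ty D h v (under (functor_ty (D ! i) (Data i))) \<Longrightarrow> val_ty D h (Ptr l) (SafeData i)"
| v_pair: "cell_at h l (PairCell u v) \<Longrightarrow> val_ty D h u A \<Longrightarrow> val_ty D h v B \<Longrightarrow> same_kind A B \<Longrightarrow>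
    val_ty D h (Ptr l) (Prod A B)"
| v_inl: "cell_at h l (InlCell v) \<Longrightarrow> val_ty D h v A \<Longrightarrow> same_kind A B \<Longrightarrow>
    val_ty D h (Ptr l) (Sum A B)"
| v_inr: "cell_at h l (InrCell v) \<Longrightarrow> val_ty D h v B \<Longrightarrow> same_kind A B \<Longrightarrow>
    val_ty D h (Ptr l) (Sum A B)"

definition env_for :: "decls \<Rightarrow> heap \<Rightarrow> ctx \<Rightarrow> env \<Rightarrow> bool" where
  "env_for D h \<Gamma> \<theta> \<longleftrightarrow>
    (\<forall>x A. map_of \<Gamma> x = Some A \<longrightarrow> (\<exists>v. map_of \<theta> x = Some v \<and> val_ty D h v A))"


section \<open>Apparent size and normal polynomials\<close>

fun cell_args :: "cell \<Rightarrow> val set" where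
  "cell_args (DataCell i v) = {v}"
| "cell_args (PairCell u v) = {u, v}"
| "cell_args (InlCell v) = {v}"
| "cell_args (InrCell v) = {v}"

inductive reach :: "heap \<Rightarrow> val \<Rightarrow> nat \<Rightarrow> bool" for h :: heap where
  reach_here: "l < length h \<Longrightarrow> reach h (Ptr l) l"
| reach_step: "cell_at h l c \<Longrightarrow> v \<in> cell_args c \<Longrightarrow> reach h v k \<Longrightarrow> reach h (Ptr l) k"

definition apparent_size :: "heap \<Rightarrow> val set \<Rightarrow> nat" where
  "apparent_size h V = card {l. (\<exists>v\<in>V. reach h v l) \<and> (\<exists>i u. cell_at h l (DataCell i u))}"

definition vars_size :: "heap \<Rightarrow> env \<Rightarrow> nat set \<Rightarrow> nat" where
  "vars_size h \<theta> X = apparent_size h {v. \<exists>x\<in>X. map_of \<theta> x = Some v}"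

text \<open>\<open>PSize x\<close> stands for the size of the value of the variable \<open>x\<close>.\<close>

datatype npoly = PConst nat | PSize nat | PAdd npoly npoly | PMul npoly npoly

fun poly_vars :: "npoly \<Rightarrow> nat set" where
  "poly_vars (PConst c) = {}"
| "poly_vars (PSize x) = {x}"
| "poly_vars (PAdd p q) = poly_vars p \<union> poly_vars q"
| "poly_vars (PMul p q) = poly_vars p \<union> poly_vars q"

fun poly_val :: "heap \<Rightarrow> env \<Rightarrow> npoly \<Rightarrow> nat" where
  "poly_val h \<theta> (PConst c) = c"
| "poly_val h \<theta> (PSize x) = vars_size h \<theta> {x}"
| "poly_val h \<theta> (PAdd p q) = poly_val h \<theta> p + poly_val h \<theta> q"
| "poly_val h \<theta> (PMul p q) = poly_val h \<theta> p * poly_val h \<theta> q"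

definition normal_poly :: "ctx \<Rightarrow> npoly \<Rightarrow> bool" where
  "normal_poly \<Gamma> p \<longleftrightarrow> (\<forall>x\<in>poly_vars p. \<exists>A. map_of \<Gamma> x = Some A \<and> normal_ground A)"


section \<open>Algorithms\<close>

text \<open>
  Effectiveness is expressed by programs of a Turing-complete first-order language over binary
  trees: a program is a list of bodies of mutually recursive one-argument functions, the body of the
  called function being evaluated with \<open>Arg\<close> bound to the argument; execution starts with function 0.
\<close>

datatype tree = Leaf | Node tree tree

datatype rexp = Arg | RLeaf | RNode rexp rexp | RLeft rexp | RRight rexp
  | RIf rexp rexp rexp | Call nat rexp

inductive run :: "rexp list \<Rightarrow> tree \<Rightarrow> rexp \<Rightarrow> tree \<Rightarrow> bool" for P :: "rexp list" where
  r_arg: "run P x Arg x"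
| r_leaf: "run P x RLeaf Leaf"
| r_node: "run P x a s \<Longrightarrow> run P x b t \<Longrightarrow> run P x (RNode a b) (Node s t)"
| r_left: "run P x a (Node s t) \<Longrightarrow> run P x (RLeft a) s"
| r_right: "run P x a (Node s t) \<Longrightarrow> run P x (RRight a) t"
| r_if_node: "run P x a (Node s t) \<Longrightarrow> run P x b r \<Longrightarrow> run P x (RIf a b c) r"
| r_if_leaf: "run P x a Leaf \<Longrightarrow> run P x c r \<Longrightarrow> run P x (RIf a b c) r"
| r_call: "k < length P \<Longrightarrow> run P x a s \<Longrightarrow> run P s (P ! k) r \<Longrightarrow> run P x (Call k a) r"

definition computes :: "rexp list \<Rightarrow> tree \<Rightarrow> tree \<Rightarrow> bool" where
  "computes P s t \<longleftrightarrow> run P s (Call 0 Arg) t"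

fun enc_nat :: "nat \<Rightarrow> tree" where
  "enc_nat 0 = Leaf"
| "enc_nat (Suc n) = Node Leaf (enc_nat n)"

fun enc_list :: "tree list \<Rightarrow> tree" where
  "enc_list [] = Leaf"
| "enc_list (t # ts) = Node t (enc_list ts)"

definition tagged :: "nat \<Rightarrow> tree list \<Rightarrow> tree" where
  "tagged k ts = Node (enc_nat k) (enc_list ts)"

fun enc_sig :: "sig \<Rightarrow> tree" where
  "enc_sig Rec = tagged 0 []"
| "enc_sig SigUnit = tagged 1 []"
| "enc_sig (SigData j) = tagged 2 [enc_nat j]"
| "enc_sig (SigSum s t) = tagged 3 [enc_sig s, enc_sig t]"
| "enc_sig (SigProd s t) = tagged 4 [enc_sig s, enc_sig t]"

fun enc_ty :: "ty \<Rightarrow> tree" where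
  "enc_ty Unit = tagged 0 []"
| "enc_ty (Data i) = tagged 1 [enc_nat i]"
| "enc_ty (SafeData i) = tagged 2 [enc_nat i]"
| "enc_ty (Sum A B) = tagged 3 [enc_ty A, enc_ty B]"
| "enc_ty (Prod A B) = tagged 4 [enc_ty A, enc_ty B]"
| "enc_ty (Arrow A B) = tagged 5 [enc_ty A, enc_ty B]"

fun enc_tm :: "tm \<Rightarrow> tree" where
  "enc_tm (Var x) = tagged 0 [enc_nat x]"
| "enc_tm (App e f) = tagged 1 [enc_tm e, enc_tm f]"
| "enc_tm (Lam x e) = tagged 2 [enc_nat x, enc_tm e]"
| "enc_tm Triv = tagged 3 []"
| "enc_tm (Pair e f) = tagged 4 [enc_tm e, enc_tm f]"
| "enc_tm (Fst e) = tagged 5 [enc_tm e]"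
| "enc_tm (Snd e) = tagged 6 [enc_tm e]"
| "enc_tm (Inl e) = tagged 7 [enc_tm e]"
| "enc_tm (Inr e) = tagged 8 [enc_tm e]"
| "enc_tm (Case e x f y g) = tagged 9 [enc_tm e, enc_nat x, enc_tm f, enc_nat y, enc_tm g]"
| "enc_tm (Con i) = tagged 10 [enc_nat i]"
| "enc_tm (Des i) = tagged 11 [enc_nat i]"
| "enc_tm (SafeCon i) = tagged 12 [enc_nat i]"
| "enc_tm (SafeDes i) = tagged 13 [enc_nat i]"
| "enc_tm (Fold i f e) = tagged 14 [enc_nat i, enc_tm f, enc_tm e]"

fun enc_poly :: "npoly \<Rightarrow> tree" where
  "enc_poly (PConst c) = tagged 0 [enc_nat c]"
| "enc_poly (PSize x) = tagged 1 [enc_nat x]"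
| "enc_poly (PAdd p q) = tagged 2 [enc_poly p, enc_poly q]"
| "enc_poly (PMul p q) = tagged 3 [enc_poly p, enc_poly q]"

definition enc_judgment :: "decls \<Rightarrow> ctx \<Rightarrow> tm \<Rightarrow> ty \<Rightarrow> tree" where
  "enc_judgment D \<Gamma> e A = enc_list
    [enc_list (map enc_sig D), enc_list (map (\<lambda>(x, B). Node (enc_nat x) (enc_ty B)) \<Gamma>),
     enc_tm e, enc_ty A]"

end

theory Submission
  imports Defs "HOL-Library.Sublist"
begin

text \<open>
  A term is interpreted symbolically: a value of ground type becomes \<open>Opaque\<close>, a function becomes an
  abstract closure, and a polynomial \<open>q\<close> is threaded through the evaluation.  Typed terms are
  hereditarily terminating under this interpretation, so it can be carried out by a program.  The
  polynomial bounds the cardinality of a set \<open>N\<close> of data cells that starts with the cells of the normal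
  inputs and absorbs every cell that is allocated; a Kripke logical relation shows that normal values
  use only cells of \<open>N\<close> and safe values only cells of \<open>N\<close> and of a set \<open>S\<close> that starts with the cells of
  the safe inputs.  A memoized recursion makes at most \<open>card N\<close> steps, and all of its steps can be
  run with the same \<open>N\<close>, because the intermediate results are safe and may be charged to \<open>S\<close>; so
  each step obeys the same bound \<open>q'\<close> and the recursion costs \<open>q + q * q'\<close>.  A lowered term has no
  safe free variables and can be evaluated with \<open>S = {}\<close>, which makes its value normal.
\<close>

section \<open>Symbolic size evaluation\<close>

text \<open>\<open>AJoin\<close> stems from \<open>Case\<close>: the branch taken depends on data
  that symbolic values do not show, so both results are kept. Constructors and destructors carry no
  type index, as their cost does not depend on it.\<close>

datatype aval = Opaque | AClo nat tm "(nat \<times> aval) list" | ACon | ADes | AJoin aval aval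

type_synonym aenv = "(nat \<times> aval) list"

text \<open>The third and fourth arguments bound the cells of \<open>N\<close> before and after.
  Both branches of a \<open>Case\<close> run in sequence, so that the final polynomial dominates
  either one. Apart from recursions only data constructors cost a cell, since pair and injection
  cells do not count. In \<open>s_fold\<close>, \<open>q2\<close> bounds the number of steps and
  \<open>q3\<close> the whole cell set after one step.\<close>

inductive
  size_eval :: "aenv \<Rightarrow> tm \<Rightarrow> npoly \<Rightarrow> npoly \<Rightarrow> aval \<Rightarrow> bool" and
  size_app :: "aval \<Rightarrow> aval \<Rightarrow> npoly \<Rightarrow> npoly \<Rightarrow> aval \<Rightarrow> bool" where
  s_var: "map_of \<rho> x = Some a \<Longrightarrow> size_eval \<rho> (Var x) q q a"
| s_app: "size_eval \<rho> e q q1 a \<Longrightarrow> size_eval \<rho> f q1 q2 b \<Longrightarrow> size_app a b q2 q3 c \<Longrightarrow>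
    size_eval \<rho> (App e f) q q3 c"
| s_lam: "size_eval \<rho> (Lam x e) q q (AClo x e \<rho>)"
| s_triv: "size_eval \<rho> Triv q q Opaque"
| s_pair: "size_eval \<rho> e q q1 a \<Longrightarrow> size_eval \<rho> f q1 q2 b \<Longrightarrow> size_eval \<rho> (Pair e f) q q2 Opaque"
| s_fst: "size_eval \<rho> e q q1 a \<Longrightarrow> size_eval \<rho> (Fst e) q q1 Opaque"
| s_snd: "size_eval \<rho> e q q1 a \<Longrightarrow> size_eval \<rho> (Snd e) q q1 Opaque"
| s_inl: "size_eval \<rho> e q q1 a \<Longrightarrow> size_eval \<rho> (Inl e) q q1 Opaque"
| s_inr: "size_eval \<rho> e q q1 a \<Longrightarrow> size_eval \<rho> (Inr e) q q1 Opaque"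
| s_case: "size_eval \<rho> e q q1 a \<Longrightarrow> size_eval ((x, Opaque) # \<rho>) f q1 q2 b \<Longrightarrow>
    size_eval ((y, Opaque) # \<rho>) g q2 q3 c \<Longrightarrow> size_eval \<rho> (Case e x f y g) q q3 (AJoin b c)"
| s_con: "size_eval \<rho> (Con i) q q ACon"
| s_des: "size_eval \<rho> (Des i) q q ADes"
| s_safe_con: "size_eval \<rho> (SafeCon i) q q ACon"
| s_safe_des: "size_eval \<rho> (SafeDes i) q q ADes"
| s_fold: "size_eval \<rho> f q q1 a \<Longrightarrow> size_eval \<rho> e q1 q2 b \<Longrightarrow> size_app a Opaque q2 q3 c \<Longrightarrow>
    size_eval \<rho> (Fold i f e) q (PAdd q2 (PMul q2 q3)) Opaque"
| sa_clo: "size_eval ((x, b) # \<rho>) e q q' c \<Longrightarrow> size_app (AClo x e \<rho>) b q q' c"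
| sa_con: "size_app ACon b q (PAdd q (PConst 1)) Opaque"
| sa_des: "size_app ADes b q q Opaque"
| sa_join: "size_app a c q q1 r \<Longrightarrow> size_app b c q1 q2 s \<Longrightarrow> size_app (AJoin a b) c q q2 (AJoin r s)"

inductive_cases size_eval_cases:
  "size_eval \<rho> (Var x) q q' a"
  "size_eval \<rho> (App e f) q q' a"
  "size_eval \<rho> (Lam x e) q q' a"
  "size_eval \<rho> Triv q q' a"
  "size_eval \<rho> (Pair e f) q q' a"
  "size_eval \<rho> (Fst e) q q' a"
  "size_eval \<rho> (Snd e) q q' a"
  "size_eval \<rho> (Inl e) q q' a"
  "size_eval \<rho> (Inr e) q q' a"
  "size_eval \<rho> (Case e x f y g) q q' a"
  "size_eval \<rho> (Con i) q q' a"
  "size_eval \<rho> (Des i) q q' a"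
  "size_eval \<rho> (SafeCon i) q q' a"
  "size_eval \<rho> (SafeDes i) q q' a"
  "size_eval \<rho> (Fold i f e) q q' a"

inductive_cases size_app_cases:
  "size_app (AClo x e \<rho>) b q q' a"
  "size_app ACon b q q' a"
  "size_app ADes b q q' a"
  "size_app (AJoin a b) c q q' r"

text \<open>Lets a bound survive the symbolic run of a branch that is not taken.\<close>

lemma size_mono:
  "size_eval \<rho> e q q' a \<Longrightarrow> poly_val h \<theta> q \<le> poly_val h \<theta> q'"
  "size_app b c q q' a \<Longrightarrow> poly_val h \<theta> q \<le> poly_val h \<theta> q'"
  by (induction rule: size_eval_size_app.inducts) auto

text \<open>No new variables arise, so every output is a normal polynomial once the initial one
  is.\<close>

lemma size_poly_vars:
  "size_eval \<rho> e q q' a \<Longrightarrow> poly_vars q' \<subseteq> poly_vars q"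
  "size_app b c q q' a \<Longrightarrow> poly_vars q' \<subseteq> poly_vars q"
  by (induction rule: size_eval_size_app.inducts) auto

section \<open>Termination of the symbolic evaluation\<close>

lemma normal_ground_imp_ground: "normal_ground A \<Longrightarrow> ground A"
  by (induction A) auto

lemma ground_under: "normal_ground A \<Longrightarrow> ground (under A)"
  by (induction A) auto

lemma safe_ground_imp_ground: "safe_ground A \<Longrightarrow> ground A"
  by (auto simp: safe_ground_def ground_under)

lemma same_kind_ground: "same_kind A B \<Longrightarrow> ground A \<and> ground B"
  by (auto simp: same_kind_def normal_ground_imp_ground safe_ground_imp_ground)

lemma ground_functor_ty: "ground A \<Longrightarrow> ground (functor_ty s A)"
  by (induction s) auto

lemma normal_functor_ty: "normal_ground A \<Longrightarrow> normal_ground (functor_ty s A)"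
  by (induction s) auto

text \<open>Products and sums with a function component have no values, since pairs and injections only
  combine ground types of the same kind.\<close>

fun halting :: "ty \<Rightarrow> aval \<Rightarrow> bool" where
  "halting (Arrow A B) a \<longleftrightarrow>
    (\<forall>b q. halting A b \<longrightarrow> (\<exists>q' c. size_app a b q q' c \<and> halting B c))"
| "halting A a \<longleftrightarrow> ground A"

lemma halting_ground: "ground A \<Longrightarrow> halting A a"
  by (cases A) auto

lemma halting_ACon: "ground B \<Longrightarrow> halting (Arrow A B) ACon"
  using sa_con halting_ground unfolding halting.simps by blast

lemma halting_ADes: "ground B \<Longrightarrow> halting (Arrow A B) ADes"
  using sa_des halting_ground unfolding halting.simps by blast

text \<open>\<open>halting\<close> quantifies over every starting polynomial, so the second function
  can start from the polynomial left by the first.\<close>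

lemma halting_AJoin: "halting A a \<Longrightarrow> halting A b \<Longrightarrow> halting A (AJoin a b)"
proof (induction A arbitrary: a b)
  case (Arrow A B)
  show ?case
  proof (clarsimp)
    fix c q assume c: "halting A c"
    obtain q1 r where r: "size_app a c q q1 r" "halting B r"
      using Arrow.prems(1) c by fastforce
    obtain q2 s where s: "size_app b c q1 q2 s" "halting B s"
      using Arrow.prems(2) c by fastforce
    show "\<exists>q' d. size_app (AJoin a b) c q q' d \<and> halting B d"
      using sa_join[OF r(1) s(1)] Arrow.IH(2)[OF r(2) s(2)] by blast
  qed
qed auto

lemma map_of_extend:
  assumes "\<And>y B. map_of \<Gamma> y = Some B \<Longrightarrow> \<exists>a. map_of \<rho> y = Some a \<and> P B a" and "P A b"
    and "map_of ((x, A) # \<Gamma>) y = Some B"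
  shows "\<exists>a. map_of ((x, b) # \<rho>) y = Some a \<and> P B a"
  using assms by (auto split: if_splits)

text \<open>Reducibility argument: \<open>halting\<close> is the reducibility predicate, and the
  environment is arbitrary so that the induction passes under binders.\<close>

lemma size_eval_halts:
  assumes "typing D \<Gamma> e A"
    and "\<And>x B. map_of \<Gamma> x = Some B \<Longrightarrow> \<exists>a. map_of \<rho> x = Some a \<and> halting B a"
  shows "\<exists>q' a. size_eval \<rho> e q q' a \<and> halting A a"
  using assms
proof (induction arbitrary: \<rho> q rule: typing.induct)
  case (t_var \<Gamma> x A)
  then show ?case by (blast intro: s_var)
next
  case (t_app \<Gamma> e A B f)
  obtain q1 a where 1: "size_eval \<rho> e q q1 a" "halting (Arrow A B) a"
    using t_app.IH(1)[OF t_app.prems] by blast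
  obtain q2 b where 2: "size_eval \<rho> f q1 q2 b" "halting A b"
    using t_app.IH(2)[OF t_app.prems] by blast
  obtain q3 c where 3: "size_app a b q2 q3 c" "halting B c"
    using 1(2) 2(2) by fastforce
  show ?case using s_app[OF 1(1) 2(1) 3(1)] 3(2) by blast
next
  case (t_lam A x \<Gamma> e B)
  have "\<exists>q' c. size_app (AClo x e \<rho>) b q q' c \<and> halting B c" if b: "halting A b" for b q
  proof -
    obtain q' c where "size_eval ((x, b) # \<rho>) e q q' c" "halting B c"
      using t_lam.IH[of "(x, b) # \<rho>" q, OF map_of_extend[of \<Gamma> \<rho> halting, OF t_lam.prems b]] by blast
    then show ?thesis by (blast intro: sa_clo)
  qed
  then have "halting (Arrow A B) (AClo x e \<rho>)" by simp
  then show ?case using s_lam by blast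
next
  case (t_triv \<Gamma>)
  then show ?case using s_triv by force
next
  case (t_pair \<Gamma> e A f B)
  obtain q1 a where 1: "size_eval \<rho> e q q1 a"
    using t_pair.IH(1)[OF t_pair.prems] by blast
  obtain q2 b where 2: "size_eval \<rho> f q1 q2 b"
    using t_pair.IH(2)[OF t_pair.prems] by blast
  show ?case using s_pair[OF 1 2] same_kind_ground[OF t_pair.hyps(3)] by force
next
  case (t_fst \<Gamma> e A B)
  obtain q1 a where 1: "size_eval \<rho> e q q1 a" "halting (Prod A B) a"
    using t_fst.IH[OF t_fst.prems] by blast
  \<comment> \<open>At a product type \<open>halting\<close> just says that both components are
    ground, so \<open>Opaque\<close> is halting at \<open>A\<close>.\<close>
  then show ?case using s_fst[OF 1(1)] halting_ground by force
next
  case (t_snd \<Gamma> e A B)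
  obtain q1 a where 1: "size_eval \<rho> e q q1 a" "halting (Prod A B) a"
    using t_snd.IH[OF t_snd.prems] by blast
  then show ?case using s_snd[OF 1(1)] halting_ground by force
next
  case (t_inl \<Gamma> e A B)
  obtain q1 a where 1: "size_eval \<rho> e q q1 a"
    using t_inl.IH[OF t_inl.prems] by blast
  show ?case using s_inl[OF 1] same_kind_ground[OF t_inl.hyps(3)] by force
next
  case (t_inr \<Gamma> e B A)
  obtain q1 a where 1: "size_eval \<rho> e q q1 a"
    using t_inr.IH[OF t_inr.prems] by blast
  show ?case using s_inr[OF 1] same_kind_ground[OF t_inr.hyps(3)] by force
next
  case (t_case \<Gamma> e A B x f C y g)
  obtain q1 a where 1: "size_eval \<rho> e q q1 a" "halting (Sum A B) a"
    using t_case.IH(1)[OF t_case.prems] by blast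
  then have AB: "halting A Opaque" "halting B Opaque" by (auto intro: halting_ground)
  obtain q2 b where 2: "size_eval ((x, Opaque) # \<rho>) f q1 q2 b" "halting C b"
    using t_case.IH(2)[of "(x, Opaque) # \<rho>" q1,
      OF map_of_extend[of \<Gamma> \<rho> halting, OF t_case.prems AB(1)]] by blast
  obtain q3 c where 3: "size_eval ((y, Opaque) # \<rho>) g q2 q3 c" "halting C c"
    using t_case.IH(3)[of "(y, Opaque) # \<rho>" q2,
      OF map_of_extend[of \<Gamma> \<rho> halting, OF t_case.prems AB(2)]] by blast
  show ?case using s_case[OF 1(1) 2(1) 3(1)] halting_AJoin[OF 2(2) 3(2)] by blast
next
  case (t_con i \<Gamma>)
  then show ?case using s_con halting_ACon[of "Data i"] by (meson ground.simps)
next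
  case (t_des i \<Gamma>)
  have "ground (functor_ty (D ! i) (Data i))"
    by (simp add: ground_functor_ty)
  then show ?case using s_des halting_ADes by blast
next
  case (t_safe_con i \<Gamma>)
  then show ?case using s_safe_con halting_ACon[of "SafeData i"] by (meson ground.simps)
next
  case (t_safe_des i \<Gamma>)
  have "ground (under (functor_ty (D ! i) (Data i)))"
    by (simp add: ground_under normal_functor_ty)
  then show ?case using s_safe_des halting_ADes by blast
next
  case (t_fold i A \<Gamma> f e)
  have A: "ground A" using t_fold.hyps(2) by (rule safe_ground_imp_ground)
  obtain q1 a where 1: "size_eval \<rho> f q q1 a" "halting (Arrow (functor_ty (D ! i) A) A) a"
    using t_fold.IH(1)[OF t_fold.prems] by blast
  obtain q2 b where 2: "size_eval \<rho> e q1 q2 b"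
    using t_fold.IH(2)[OF t_fold.prems] by blast
  \<comment> \<open>\<open>A\<close> is ground, hence so is the argument type of the step function:
    a single run on \<open>Opaque\<close> stands for all recursion steps.\<close>
  have "halting (functor_ty (D ! i) A) Opaque"
    by (simp add: A halting_ground ground_functor_ty)
  then obtain q3 c where 3: "size_app a Opaque q2 q3 c" using 1(2) by fastforce
  show ?case using s_fold[OF 1(1) 2 3] halting_ground[OF A] by blast
next
  case (t_lower \<Gamma> e A)
  obtain q1 a where "size_eval \<rho> e q q1 a" using t_lower.IH[OF t_lower.prems] by blast
  then show ?case using halting_ground normal_ground_imp_ground t_lower.hyps by blast
qed

section \<open>Heaps and determinism of evaluation\<close>

inductive_cases eval_cases:
  "eval D h \<theta> (Var x) r h'"
  "eval D h \<theta> (App e f) r h'"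
  "eval D h \<theta> (Lam x e) r h'"
  "eval D h \<theta> Triv r h'"
  "eval D h \<theta> (Pair e f) r h'"
  "eval D h \<theta> (Fst e) r h'"
  "eval D h \<theta> (Snd e) r h'"
  "eval D h \<theta> (Inl e) r h'"
  "eval D h \<theta> (Inr e) r h'"
  "eval D h \<theta> (Case e x f y g) r h'"
  "eval D h \<theta> (Con i) r h'"
  "eval D h \<theta> (Des i) r h'"
  "eval D h \<theta> (SafeCon i) r h'"
  "eval D h \<theta> (SafeDes i) r h'"
  "eval D h \<theta> (Fold i f e) r h'"
  "app_eval D h (Clo x e \<theta>) v r h'"
  "app_eval D h (VCon i) v r h'"
  "app_eval D h (VDes i) v r h'"
  "fold_eval D g i M h (Ptr l) r M' h'"
  "map_eval D g i Rec M h v r M' h'"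
  "map_eval D g i SigUnit M h v r M' h'"
  "map_eval D g i (SigData j) M h v r M' h'"
  "map_eval D g i (SigSum s t) M h v r M' h'"
  "map_eval D g i (SigProd s t) M h v r M' h'"

lemma cell_at_unique: "cell_at h l c \<Longrightarrow> cell_at h l c' \<Longrightarrow> c = c'"
  by (simp add: cell_at_def)

text \<open>Addresses are fixed by the length of the heap and memo hits by the table, so even heaps
  and tables agree. This carries the bound from the one evaluation that the logical relation
  constructs to every evaluation.\<close>

lemma eval_deterministic:
  "eval D h \<theta> e v h' \<Longrightarrow> eval D h \<theta> e v' h'' \<Longrightarrow> v' = v \<and> h'' = h'"
  "app_eval D h u w v h' \<Longrightarrow> app_eval D h u w v' h'' \<Longrightarrow> v' = v \<and> h'' = h'"
  "fold_eval D g i M h w v M' h' \<Longrightarrow> fold_eval D g i M h w v' M'' h'' \<Longrightarrow>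
    v' = v \<and> M'' = M' \<and> h'' = h'"
  "map_eval D g i s M h w v M' h' \<Longrightarrow> map_eval D g i s M h w v' M'' h'' \<Longrightarrow>
    v' = v \<and> M'' = M' \<and> h'' = h'"
  apply (induction arbitrary: v' h'' and v' h'' and v' M'' h'' and v' M'' h''
    rule: eval_app_eval_fold_eval_map_eval.inducts)
  apply (erule eval_cases; simp)
  apply (erule eval_cases, metis)
  apply (erule eval_cases; simp)
  apply (erule eval_cases; simp)
  apply (erule eval_cases, metis)
  apply (erule eval_cases, metis cell_at_unique val.inject(1) cell.inject(2))
  apply (erule eval_cases, metis cell_at_unique val.inject(1) cell.inject(2))
  apply (erule eval_cases, metis)
  apply (erule eval_cases, metis)
  apply (erule eval_cases, metis cell_at_unique val.inject(1) cell.inject(3), metis cell_at_unique val.inject(1) cell.distinct)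
  apply (erule eval_cases, metis cell_at_unique val.inject(1) cell.distinct, metis cell_at_unique val.inject(1) cell.inject(4))
  apply (erule eval_cases; simp)
  apply (erule eval_cases; simp)
  apply (erule eval_cases; simp)
  apply (erule eval_cases; simp)
  subgoal premises prems for h \<theta> f g h1 e v h2 i r M h3 v' h''
    using prems(7)
  proof (rule eval_cases(15))
    fix g' h1' w' h2' M'
    assume 1: "eval D h \<theta> f g' h1'" and 2: "eval D h1' \<theta> e w' h2'"
      and 3: "fold_eval D g' i Map.empty h2' w' v' M' h''"
    \<comment> \<open>The premises are compared in the order of evaluation, each equality
      identifying the heap and values from which the next one starts.\<close>
    have "g' = g \<and> h1' = h1" using prems(2) 1 by blast
    moreover from this have "w' = v \<and> h2' = h2" using prems(4) 2 by blast
    ultimately show ?thesis using prems(6) 3 by blast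
  qed
  apply (erule eval_cases, metis)
  apply (erule eval_cases; simp)
  apply (erule eval_cases, metis cell_at_unique val.inject(1) cell.inject(1))
  apply (erule eval_cases, simp, simp)
  subgoal premises prems for M l h i v g w M1 h1 r h2 v' M'' h''
    using prems(7)
  proof (rule eval_cases(19))
    fix w1 w' M1' h1'
    assume 1: "cell_at h l (DataCell i w1)" and 2: "map_eval D g i (D ! i) M h w1 w' M1' h1'"
      and 3: "app_eval D h1' g w' v' h''" and 4: "M'' = M1'(l \<mapsto> v')"
    have "w1 = v" using cell_at_unique[OF 1 prems(2)] by simp
    then have "w' = w \<and> M1' = M1 \<and> h1' = h1" using prems(4) 2 by blast
    then show ?thesis using prems(6) 3 4 by blast
  qed (use prems(1) in simp)
  apply (erule eval_cases, metis)
  apply (erule eval_cases; simp)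
  apply (erule eval_cases; simp)
  apply (erule eval_cases, metis cell_at_unique val.inject(1) cell.inject(3), metis cell_at_unique val.inject(1) cell.distinct)
  apply (erule eval_cases, metis cell_at_unique val.inject(1) cell.distinct, metis cell_at_unique val.inject(1) cell.inject(4))
  apply (erule eval_cases, metis cell_at_unique val.inject(1) cell.inject(2))
  done

section \<open>The logical relation\<close>

text \<open>Sets instead of numbers: shared cells are then counted once, and \<open>N\<close> and
  \<open>S\<close> can bound them by inclusion.\<close>

definition data_cells :: "heap \<Rightarrow> val \<Rightarrow> nat set" where
  "data_cells h v = {l. reach h v l \<and> (\<exists>i u. cell_at h l (DataCell i u))}"

lemma cell_at_prefix: "cell_at h l c \<Longrightarrow> prefix h h' \<Longrightarrow> cell_at h' l c"
  by (auto simp: cell_at_def prefix_def nth_append)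

lemma val_ty_prefix: "val_ty D h v A \<Longrightarrow> prefix h h' \<Longrightarrow> val_ty D h' v A"
  by (induction rule: val_ty.induct) (auto intro: val_ty.intros cell_at_prefix)

inductive_cases reach_VTriv: "reach h VTriv l"
inductive_cases reach_Ptr: "reach h (Ptr l) k"

lemma reach_Ptr_iff:
  "cell_at h l c \<Longrightarrow> reach h (Ptr l) k \<longleftrightarrow> k = l \<or> (\<exists>v\<in>cell_args c. reach h v k)"
  by (auto elim!: reach_Ptr intro: reach.intros dest: cell_at_unique simp: cell_at_def)

text \<open>A typed value has no dangling pointers, so appended cells stay out of its reach; for an
  untyped pointer beyond the end of \<open>h\<close> this fails.\<close>

lemma reach_prefix:
  "val_ty D h v A \<Longrightarrow> prefix h h' \<Longrightarrow> reach h' v l \<longleftrightarrow> reach h v l"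
proof (induction rule: val_ty.induct)
  case v_triv
  then show ?case by (auto elim: reach_VTriv)
qed (simp_all add: reach_Ptr_iff[OF cell_at_prefix] reach_Ptr_iff)

lemma reach_bound: "reach h v l \<Longrightarrow> l < length h"
  by (induction rule: reach.induct)

lemma data_cells_prefix:
  assumes "val_ty D h v A" "prefix h h'"
  shows "data_cells h' v = data_cells h v"
proof -
  have "cell_at h' l c \<longleftrightarrow> cell_at h l c" if "reach h v l" for l c
    using reach_bound[OF that] assms(2) by (auto simp: cell_at_def prefix_def nth_append)
  then show ?thesis using reach_prefix[OF assms] by (auto simp: data_cells_def)
qed

lemma data_cells_VTriv [simp]: "data_cells h VTriv = {}"
  by (auto simp: data_cells_def elim: reach_VTriv)

lemma data_cells_simps:
  "cell_at h l (DataCell i u) \<Longrightarrow> data_cells h (Ptr l) = insert l (data_cells h u)"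
  "cell_at h l (PairCell u v) \<Longrightarrow> data_cells h (Ptr l) = data_cells h u \<union> data_cells h v"
  "cell_at h l (InlCell u) \<Longrightarrow> data_cells h (Ptr l) = data_cells h u"
  "cell_at h l (InrCell u) \<Longrightarrow> data_cells h (Ptr l) = data_cells h u"
  by (auto simp: data_cells_def reach_Ptr_iff dest: cell_at_unique)

text \<open>Induction step for \<open>val_ty_acyclic\<close>, common to all cell kinds: a cycle
  either passes through the root \<open>l0\<close> or lies below one of its arguments.\<close>

lemma acyclic_step:
  assumes "cell_at h l0 c0"
    and "\<And>w l c u. w \<in> cell_args c0 \<Longrightarrow> reach h w l \<Longrightarrow> cell_at h l c \<Longrightarrow> u \<in> cell_args c \<Longrightarrow>
      \<not> reach h u l"
    and "reach h (Ptr l0) l" "cell_at h l c" "u \<in> cell_args c"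
  shows "\<not> reach h u l"
proof (cases "l = l0")
  case True
  then have "c = c0" using assms(1,4) cell_at_unique by blast
  \<comment> \<open>A path from \<open>u\<close> back to \<open>l = l0\<close> lets the assumption
    be used with \<open>w = u\<close>, which denies that very path.\<close>
  then show ?thesis using assms(2)[of u l c u] assms(4,5) by blast
next
  case False
  then obtain w where "w \<in> cell_args c0" "reach h w l"
    using reach_Ptr_iff[OF assms(1)] assms(3) by blast
  then show ?thesis using assms(2,4,5) by blast
qed

text \<open>A typing derivation is finite and has a subderivation for every argument, which rules
  out cycles below the value, whatever the rest of the heap looks like. In a fold this shows that
  treating the arguments of a cell does not memoize the cell itself.\<close>

lemma val_ty_acyclic:
  assumes "val_ty D h v A" "reach h v l" "cell_at h l c" "u \<in> cell_args c"
  shows "\<not> reach h u l"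
  using assms
proof (induction arbitrary: l c u rule: val_ty.induct)
  case v_triv
  then show ?case by (auto elim: reach_VTriv)
next
  case (v_data l0 i v)
  show ?case
    by (rule acyclic_step[OF v_data.hyps(1) _ v_data.prems]) (use v_data.IH in simp)
next
  case (v_safe_data l0 i v)
  show ?case
    by (rule acyclic_step[OF v_safe_data.hyps(1) _ v_safe_data.prems]) (use v_safe_data.IH in simp)
next
  case (v_pair l0 u v A B)
  show ?case
    by (rule acyclic_step[OF v_pair.hyps(1) _ v_pair.prems]) (metis cell_args.simps(2) insertE singletonD v_pair.IH)
next
  case (v_inl l0 v A B)
  show ?case
    by (rule acyclic_step[OF v_inl.hyps(1) _ v_inl.prems]) (use v_inl.IH in simp)
next
  case (v_inr l0 v B A)
  show ?case
    by (rule acyclic_step[OF v_inr.hyps(1) _ v_inr.prems]) (use v_inr.IH in simp)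
qed

section \<open>Ground values: lowering and unmixed kinds\<close>

inductive_cases val_ty_cases:
  "val_ty D h v Unit"
  "val_ty D h v (Data i)"
  "val_ty D h v (SafeData i)"
  "val_ty D h v (Prod A B)"
  "val_ty D h v (Sum A B)"
  "val_ty D h v (Arrow A B)"

lemma val_ty_Prod_iff:
  "val_ty D h v (Prod A B) \<longleftrightarrow> same_kind A B \<and>
    (\<exists>l u w. v = Ptr l \<and> cell_at h l (PairCell u w) \<and> val_ty D h u A \<and> val_ty D h w B)"
  by (blast elim: val_ty_cases intro: v_pair)

lemma val_ty_Sum_iff:
  "val_ty D h v (Sum A B) \<longleftrightarrow> same_kind A B \<and>
    (\<exists>l u. v = Ptr l \<and> (cell_at h l (InlCell u) \<and> val_ty D h u A \<or>
      cell_at h l (InrCell u) \<and> val_ty D h u B))"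
  by (blast elim: val_ty_cases intro: v_inl v_inr)

lemma same_kind_normal: "normal_ground A \<Longrightarrow> normal_ground B \<Longrightarrow> same_kind A B"
  by (simp add: same_kind_def)

lemma same_kind_under: "normal_ground A \<Longrightarrow> normal_ground B \<Longrightarrow> same_kind (under A) (under B)"
  by (auto simp: same_kind_def safe_ground_def)

text \<open>Safe and normal constructors build the same cells, so a safe typing derivation can be
  copied with normal types. Induction on \<open>A\<close> would not do, since the contents of a
  \<open>SafeData\<close> cell have an unfolded type.\<close>

lemma val_ty_under:
  "val_ty D h v (under A) \<Longrightarrow> normal_ground A \<Longrightarrow> val_ty D h v A"
proof (induction "under A" arbitrary: A rule: val_ty.induct)
  case v_triv
  then show ?case by (cases A) (auto intro: val_ty.intros)
next
  case (v_data l i v)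
  then show ?case by (cases A) auto
next
  case (v_safe_data l i v)
  then have "A = Data i" by (cases A) auto
  then show ?case
    using v_safe_data by (auto intro!: val_ty.v_data[of h l i v] simp: normal_functor_ty)
next
  case (v_pair l u v B C)
  then obtain A1 A2 where "A = Prod A1 A2" by (cases A) auto
  then show ?case using v_pair by (auto intro!: val_ty.v_pair same_kind_normal)
next
  case (v_inl l v B C)
  then obtain A1 A2 where "A = Sum A1 A2" by (cases A) auto
  then show ?case using v_inl by (auto intro!: val_ty.v_inl[of h l v] same_kind_normal)
next
  case (v_inr l v C B)
  then obtain A1 A2 where "A = Sum A1 A2" by (cases A) auto
  then show ?case using v_inr by (auto intro!: val_ty.v_inr[of h l v] same_kind_normal)
qed

text \<open>The kind condition on pairs and injections excludes mixed values, so each input can be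
  charged wholly to \<open>N\<close> or wholly to \<open>S\<close>.\<close>

lemma val_ty_kind: "val_ty D h v A \<Longrightarrow> normal_ground A \<or> safe_ground A"
proof (induction rule: val_ty.induct)
  case (v_safe_data l i v)
  then show ?case
    unfolding safe_ground_def by (metis normal_ground.simps(2) under.simps(1))
next
  case (v_pair l u v A B)
  then show ?case
    unfolding safe_ground_def same_kind_def by (metis normal_ground.simps(5) under.simps(3))
next
  case (v_inl l v A B)
  then show ?case
    unfolding safe_ground_def same_kind_def by (metis normal_ground.simps(4) under.simps(2))
next
  case (v_inr l v A B)
  then show ?case
    unfolding safe_ground_def same_kind_def by (metis normal_ground.simps(4) under.simps(2))
qed auto

section \<open>The Kripke relation between values and abstract values\<close>

context
  fixes D :: decls and h0 :: heap and \<theta>0 :: env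
begin

text \<open>A world consists of \<open>N\<close>, \<open>S\<close> and the heap. A function takes
  any later world and any polynomial bounding \<open>card N'\<close> to a terminating call in which
  \<open>N'\<close> may grow but \<open>S'\<close> may not; this is how safe cells enter the bound
  with coefficient one. Polynomials are always read at the initial \<open>h0\<close> and
  \<open>\<theta>0\<close>. Sums and products are described by components and not by
  \<open>val_ty\<close>, because arguments of recursion steps mix normal and safe parts.\<close>

fun good :: "nat set \<Rightarrow> nat set \<Rightarrow> heap \<Rightarrow> ty \<Rightarrow> val \<Rightarrow> aval \<Rightarrow> bool" where
  "good N S h Unit v a \<longleftrightarrow> v = VTriv"
| "good N S h (Data i) v a \<longleftrightarrow> val_ty D h v (Data i) \<and> data_cells h v \<subseteq> N"
| "good N S h (SafeData i) v a \<longleftrightarrow> val_ty D h v (SafeData i) \<and> data_cells h v \<subseteq> N \<union> S"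
| "good N S h (Sum A B) v a \<longleftrightarrow> ground A \<and> ground B \<and>
    (\<exists>l u. v = Ptr l \<and> (cell_at h l (InlCell u) \<and> good N S h A u Opaque \<or>
      cell_at h l (InrCell u) \<and> good N S h B u Opaque))"
| "good N S h (Prod A B) v a \<longleftrightarrow> ground A \<and> ground B \<and>
    (\<exists>l u w. v = Ptr l \<and> cell_at h l (PairCell u w) \<and>
      good N S h A u Opaque \<and> good N S h B w Opaque)"
| "good N S h (Arrow A B) v a \<longleftrightarrow>
    (\<forall>N' S' h' u b q q' r. N \<subseteq> N' \<and> S \<subseteq> S' \<and> prefix h h' \<and> finite N' \<and>
      card N' \<le> poly_val h0 \<theta>0 q \<and> good N' S' h' A u b \<and> size_app a b q q' r \<longrightarrow>
      (\<exists>w h'' N''. app_eval D h' v u w h'' \<and> prefix h' h'' \<and> N' \<subseteq> N'' \<and> finite N'' \<and>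
        card N'' \<le> poly_val h0 \<theta>0 q' \<and> good N'' S' h'' B w r))"

lemma good_ArrowD:
  assumes "good N S h (Arrow A B) v a" "N \<subseteq> N'" "S \<subseteq> S'" "prefix h h'" "finite N'"
    "card N' \<le> poly_val h0 \<theta>0 q" "good N' S' h' A u b" "size_app a b q q' r"
  shows "\<exists>w h'' N''. app_eval D h' v u w h'' \<and> prefix h' h'' \<and> N' \<subseteq> N'' \<and> finite N'' \<and>
    card N'' \<le> poly_val h0 \<theta>0 q' \<and> good N'' S' h'' B w r"
  using assms(1)[unfolded good.simps, rule_format, of N' S' h' q u b q' r] assms(2-) by blast

lemma good_mono:
  "good N S h A v a \<Longrightarrow> N \<subseteq> N' \<Longrightarrow> S \<subseteq> S' \<Longrightarrow> prefix h h' \<Longrightarrow> good N' S' h' A v a"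
proof (induction A arbitrary: v a)
  case (Arrow A B)
  show ?case unfolding good.simps
  proof (intro allI impI, elim conjE)
    fix N'' S'' h'' u b q q' r
    assume "N' \<subseteq> N''" "S' \<subseteq> S''" "prefix h' h''"
    with Arrow.prems have "N \<subseteq> N''" "S \<subseteq> S''" "prefix h h''"
      by (auto intro: prefix_order.trans)
    moreover assume "finite N''" "card N'' \<le> poly_val h0 \<theta>0 q" "good N'' S'' h'' A u b"
      "size_app a b q q' r"
    ultimately show "\<exists>w h''' N'''. app_eval D h'' v u w h''' \<and> prefix h'' h''' \<and> N'' \<subseteq> N''' \<and>
        finite N''' \<and> card N''' \<le> poly_val h0 \<theta>0 q' \<and> good N''' S'' h''' B w r"
      by (rule good_ArrowD[OF Arrow.prems(1)])
  qed
next
  case (Sum A B)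
  then show ?case by simp (blast intro: cell_at_prefix)
next
  case (Prod A B)
  then show ?case by simp (blast intro: cell_at_prefix)
next
  case (Data i)
  then have v: "val_ty D h v (Data i)" "data_cells h v \<subseteq> N" by auto
  then show ?case
    using Data.prems val_ty_prefix[OF v(1) Data.prems(4)]
      data_cells_prefix[OF v(1) Data.prems(4)] by auto
next
  case (SafeData i)
  then have v: "val_ty D h v (SafeData i)" "data_cells h v \<subseteq> N \<union> S" by auto
  then show ?case
    using SafeData.prems val_ty_prefix[OF v(1) SafeData.prems(4)]
      data_cells_prefix[OF v(1) SafeData.prems(4)] by auto
qed simp

lemma good_ground_cong: "ground A \<Longrightarrow> good N S h A v a \<Longrightarrow> good N S h A v b"
  by (cases A) auto

text \<open>The call made by \<open>v\<close> follows only one of \<open>a\<close> and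
  \<open>b\<close>; by \<open>size_mono\<close> the symbolic run of the other one, before or after
  it, merely raises the bound.\<close>

lemma good_AJoin:
  "good N S h A v a \<Longrightarrow> good N S h A v (AJoin a b)"
  "good N S h A v b \<Longrightarrow> good N S h A v (AJoin a b)"
proof (induction A arbitrary: N S h v a b)
  case (Arrow A B)
  { case 1
    show ?case unfolding good.simps
    proof (intro allI impI, elim conjE)
      fix N' S' h' u c q q' r
      assume *: "N \<subseteq> N'" "S \<subseteq> S'" "prefix h h'" "finite N'" "card N' \<le> poly_val h0 \<theta>0 q"
        "good N' S' h' A u c" and "size_app (AJoin a b) c q q' r"
      then obtain q1 r1 r2 where s: "size_app a c q q1 r1" "size_app b c q1 q' r2" "r = AJoin r1 r2"
        by (auto elim: size_app_cases)
      then obtain w h'' N'' where w: "app_eval D h' v u w h''" "prefix h' h''" "N' \<subseteq> N''" "finite N''"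
        "card N'' \<le> poly_val h0 \<theta>0 q1" "good N'' S' h'' B w r1"
        using good_ArrowD[OF 1 *] by blast
      have "card N'' \<le> poly_val h0 \<theta>0 q'" using w(5) size_mono(2)[OF s(2)] by (rule le_trans)
      then show "\<exists>w h'' N''. app_eval D h' v u w h'' \<and> prefix h' h'' \<and> N' \<subseteq> N'' \<and> finite N'' \<and>
          card N'' \<le> poly_val h0 \<theta>0 q' \<and> good N'' S' h'' B w r"
        using w(1-4) Arrow.IH(3)[OF w(6)] s(3) by blast
    qed
  next
    case 2
    show ?case unfolding good.simps
    proof (intro allI impI, elim conjE)
      fix N' S' h' u c q q' r
      assume *: "N \<subseteq> N'" "S \<subseteq> S'" "prefix h h'" "finite N'" "card N' \<le> poly_val h0 \<theta>0 q"
        "good N' S' h' A u c" and "size_app (AJoin a b) c q q' r"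
      then obtain q1 r1 r2 where s: "size_app a c q q1 r1" "size_app b c q1 q' r2" "r = AJoin r1 r2"
        by (auto elim: size_app_cases)
      have "card N' \<le> poly_val h0 \<theta>0 q1" using *(5) size_mono(2)[OF s(1)] le_trans by blast
      then obtain w h'' N'' where w: "app_eval D h' v u w h''" "prefix h' h''" "N' \<subseteq> N''" "finite N''"
        "card N'' \<le> poly_val h0 \<theta>0 q'" "good N'' S' h'' B w r2"
        using good_ArrowD[OF 2 *(1-4) _ *(6) s(2)] by blast
      then show "\<exists>w h'' N''. app_eval D h' v u w h'' \<and> prefix h' h'' \<and> N' \<subseteq> N'' \<and> finite N'' \<and>
          card N'' \<le> poly_val h0 \<theta>0 q' \<and> good N'' S' h'' B w r"
        using Arrow.IH(4)[OF w(6)] s(3) by blast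
    qed
  }
qed auto

text \<open>For normal types the componentwise description collapses to typing plus inclusion of
  cells, the form used at constructors, destructors and lowering; \<open>good_under_iff\<close> is
  the safe counterpart.\<close>

lemma good_normal_iff:
  "normal_ground A \<Longrightarrow> good N S h A v a \<longleftrightarrow> val_ty D h v A \<and> data_cells h v \<subseteq> N"
proof (induction A arbitrary: v a)
  case (Sum A B)
  then show ?case
    by (simp add: val_ty_Sum_iff same_kind_normal normal_ground_imp_ground)
      (auto simp: data_cells_simps)
next
  case (Prod A B)
  then show ?case
    by (simp add: val_ty_Prod_iff same_kind_normal normal_ground_imp_ground)
      (auto simp: data_cells_simps, blast)
qed (auto elim: val_ty_cases intro: v_triv)

lemma good_under_iff:
  "normal_ground A \<Longrightarrow>
    good N S h (under A) v a \<longleftrightarrow> val_ty D h v (under A) \<and> data_cells h v \<subseteq> N \<union> S"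
proof (induction A arbitrary: v a)
  case (Sum A B)
  then show ?case
    by (simp add: val_ty_Sum_iff same_kind_under ground_under)
      (auto simp: data_cells_simps)
next
  case (Prod A B)
  then show ?case
    by (simp add: val_ty_Prod_iff same_kind_under ground_under)
      (auto simp: data_cells_simps, blast)
qed (auto elim: val_ty_cases intro: v_triv)

lemma good_safe_iff:
  "safe_ground A \<Longrightarrow> good N S h A v a \<longleftrightarrow> val_ty D h v A \<and> data_cells h v \<subseteq> N \<union> S"
  using good_under_iff by (auto simp: safe_ground_def)

lemma good_data_cells: "ground A \<Longrightarrow> good N S h A v a \<Longrightarrow> data_cells h v \<subseteq> N \<union> S"
  by (induction A arbitrary: v a) (auto simp: data_cells_simps, blast+)

lemma normal_groundI: "ground A \<Longrightarrow> \<not> yields_safe A \<Longrightarrow> normal_ground A"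
  by (induction A) auto

text \<open>A function whose result is normal cannot return the safe cells it has captured.\<close>

lemma good_discard_safe:
  "\<not> yields_safe A \<Longrightarrow> good N S h A v a \<Longrightarrow> good N {} h A v a"
proof (induction A arbitrary: N S h v a)
  case (Arrow A B)
  show ?case unfolding good.simps
  proof (intro allI impI, elim conjE)
    fix N' S' h' u b q q' r
    assume *: "N \<subseteq> N'" "prefix h h'" "finite N'" "card N' \<le> poly_val h0 \<theta>0 q"
      "size_app a b q q' r" and "good N' S' h' A u b"
    \<comment> \<open>The captured safe cells \<open>S\<close> are added to those of the new world
      for the call. Since \<open>B\<close> yields no safe data, the induction hypothesis drops all
      safe cells from the result, and monotonicity puts \<open>S'\<close> back.\<close>
    then have "good N' (S' \<union> S) h' A u b" using good_mono by blast
    then obtain w h'' N'' where "app_eval D h' v u w h''" "prefix h' h''" "N' \<subseteq> N''" "finite N''"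
      "card N'' \<le> poly_val h0 \<theta>0 q'" "good N'' (S' \<union> S) h'' B w r"
      using good_ArrowD[OF Arrow.prems(2) *(1) Un_upper2 *(2-4) _ *(5)] by blast
    moreover from this have "good N'' S' h'' B w r"
      using Arrow.IH(2) Arrow.prems(1) good_mono by (metis empty_subsetI prefix_order.refl subset_refl yields_safe.simps(6))
    ultimately show "\<exists>w h'' N''. app_eval D h' v u w h'' \<and> prefix h' h'' \<and> N' \<subseteq> N'' \<and> finite N'' \<and>
        card N'' \<le> poly_val h0 \<theta>0 q' \<and> good N'' S' h'' B w r" by blast
  qed
next
  case (Sum A B)
  \<comment> \<open>At a normal ground type the relation does not depend on the safe cells.\<close>
  then have "normal_ground (Sum A B)" by (auto intro: normal_groundI)
  then show ?case using Sum.prems good_normal_iff by blast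
next
  case (Prod A B)
  then have "normal_ground (Prod A B)" by (auto intro: normal_groundI)
  then show ?case using Prod.prems good_normal_iff by blast
qed auto

section \<open>Memoized recursion\<close>

text \<open>\<open>c\<close> bounds the cost of a step, \<open>dom M\<close> counts the steps made,
  and \<open>X\<close> gathers the cell sets that they returned. \<open>dom M \<subseteq> N\<close>
  caps the number of steps at \<open>card N\<close>.\<close>

definition memo_inv :: "heap \<Rightarrow> nat set \<Rightarrow> nat set \<Rightarrow> ty \<Rightarrow> nat \<Rightarrow>
    (nat \<rightharpoonup> val) \<Rightarrow> heap \<Rightarrow> nat set \<Rightarrow> bool" where
  "memo_inv h1 N S A c M h X \<longleftrightarrow> prefix h1 h \<and> dom M \<subseteq> N \<and> finite X \<and> card X \<le> card (dom M) * c \<and>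
    (\<forall>l r. M l = Some r \<longrightarrow> good N (S \<union> X) h A r Opaque)"

lemma memo_invD:
  assumes "memo_inv h1 N S A c M h X"
  shows "prefix h1 h" "dom M \<subseteq> N" "finite X" "card X \<le> card (dom M) * c"
    and "M l = Some r \<Longrightarrow> good N (S \<union> X) h A r Opaque"
  using assms by (auto simp: memo_inv_def)

lemma memo_inv_prefix:
  assumes "memo_inv h1 N S A c M h X" "prefix h h'"
  shows "memo_inv h1 N S A c M h' X"
  using assms good_mono[OF _ subset_refl subset_refl assms(2)] prefix_order.trans
  unfolding memo_inv_def by blast

text \<open>The cells allocated by a step are charged to the safe part \<open>X\<close>, not to \<open>N\<close>; hence the bound
  \<open>q'\<close> for a single step stays valid during the whole recursion.\<close>

lemma map_eval_good:
  assumes g: "good N S h1 (Arrow (functor_ty (D ! i) A) A) g a"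
    and N: "finite N" "card N \<le> poly_val h0 \<theta>0 q"
    and step: "size_app a Opaque q q' b"
    and A: "safe_ground A"
    and v: "val_ty D h1 v B" "data_cells h1 v \<subseteq> N" "B = functor_ty s (Data i)"
    and inv: "memo_inv h1 N S A (poly_val h0 \<theta>0 q') M h X"
  shows "\<exists>w M' h' X'. map_eval D g i s M h v w M' h' \<and> prefix h h' \<and> X \<subseteq> X' \<and>
    memo_inv h1 N S A (poly_val h0 \<theta>0 q') M' h' X' \<and> dom M' \<subseteq> dom M \<union> data_cells h1 v \<and>
    good N (S \<union> X') h' (functor_ty s A) w Opaque"
  using v inv
\<comment> \<open>Induction on the typing of the traversed value in the heap \<open>h1\<close> where
  the fold starts: the heap grows meanwhile, but only cells of \<open>h1\<close> are
  traversed.\<close>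
proof (induction arbitrary: s M h X rule: val_ty.induct)
  case v_triv
  then have "s = SigUnit" by (cases s) auto
  then show ?case using v_triv m_unit by fastforce
next
  case (v_data l j v)
  note h1h = memo_invD(1)[OF v_data.prems(3)]
  \<comment> \<open>Data met during the traversal either belongs to a constant part of the signature
    and is passed on unchanged, or is a recursive occurrence.\<close>
  consider "s = SigData j" | "s = Rec" "j = i" using v_data.prems(2) by (cases s) auto
  then show ?case
  proof cases
    case 1
    have "val_ty D h1 (Ptr l) (Data j)" using v_data.hyps by (rule val_ty.v_data)
    then have "good N (S \<union> X) h (Data j) (Ptr l) Opaque"
      using v_data.prems(1) h1h val_ty_prefix[of D h1 "Ptr l" "Data j" h]
        data_cells_prefix[of D h1 "Ptr l" "Data j" h] by auto
    then show ?thesis using 1 v_data.prems(3) m_data by fastforce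
  next
    case 2
    show ?thesis
    proof (cases "M l")
      case (Some r)
      then have "map_eval D g i Rec M h (Ptr l) r M h" by (intro m_rec f_memo)
      then show ?thesis using 2 v_data.prems(3) memo_invD(5)[OF v_data.prems(3) Some] by fastforce
    next
      case None
      have cells: "data_cells h1 (Ptr l) = insert l (data_cells h1 v)"
        using v_data.hyps(1) by (rule data_cells_simps)
      obtain w M1 h2 X1 where m: "map_eval D g i (D ! i) M h v w M1 h2" "prefix h h2" "X \<subseteq> X1"
        "memo_inv h1 N S A (poly_val h0 \<theta>0 q') M1 h2 X1" "dom M1 \<subseteq> dom M \<union> data_cells h1 v"
        "good N (S \<union> X1) h2 (functor_ty (D ! i) A) w Opaque"
        using v_data.IH[of "D ! i" M h X] v_data.prems 2 cells by auto
      note inv1 = memo_invD[OF m(4)]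
      \<comment> \<open>Each step restarts from \<open>N\<close> and its bound \<open>q\<close>,
        with all earlier cells in the safe part \<open>S \<union> X1\<close>; so \<open>N'\<close>
        obeys the same bound \<open>q'\<close> every time.\<close>
      obtain r h3 N' where r: "app_eval D h2 g w r h3" "prefix h2 h3" "N \<subseteq> N'" "finite N'"
        "card N' \<le> poly_val h0 \<theta>0 q'" "good N' (S \<union> X1) h3 A r b"
        using good_ArrowD[OF g subset_refl Un_upper1 inv1(1) N m(6) step] by blast
      \<comment> \<open>By acyclicity \<open>l\<close> is not among the cells below it, so it has
        not been memoized in the meantime and its entry enlarges \<open>dom M1\<close> by one. This
        pays for \<open>N'\<close> in the bound on \<open>X1 \<union> N'\<close>.\<close>
      have "reach h1 (Ptr l) l" using v_data.hyps(1) by (auto simp: cell_at_def intro: reach_here)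
      then have "l \<notin> data_cells h1 v"
        using val_ty_acyclic[OF val_ty.v_data[OF v_data.hyps]] v_data.hyps(1)
        by (auto simp: data_cells_def)
      then have l: "l \<notin> dom M1" using None m(5) by auto
      have sub: "S \<union> X1 \<subseteq> S \<union> (X1 \<union> N')" by blast
      \<comment> \<open>At the safe type \<open>A\<close> only the union of both parts matters, so
        the cells of \<open>N'\<close> can be moved to the safe one.\<close>
      have "good N (S \<union> (X1 \<union> N')) h3 A r Opaque"
        using r(6) by (auto simp: good_safe_iff[OF A])
      moreover have "good N (S \<union> (X1 \<union> N')) h3 A r' Opaque" if "M1 l' = Some r'" for l' r'
        using good_mono[OF inv1(5)[OF that] subset_refl sub r(2)] .
      moreover have "finite (dom M1)" using inv1(2) N(1) finite_subset by blast
      then have "card (X1 \<union> N') \<le> card (dom (M1(l \<mapsto> r))) * poly_val h0 \<theta>0 q'"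
        using card_Un_le[of X1 N'] inv1(4) r(5) l by simp
      moreover have "l \<in> N" using v_data.prems(1) cells by simp
      ultimately have "memo_inv h1 N S A (poly_val h0 \<theta>0 q') (M1(l \<mapsto> r)) h3 (X1 \<union> N')"
        using inv1(1-3) r(2,4) prefix_order.trans by (auto simp: memo_inv_def)
      moreover have "map_eval D g i Rec M h (Ptr l) r (M1(l \<mapsto> r)) h3"
        using m_rec[OF f_step[OF None _ m(1) r(1)]] cell_at_prefix[OF v_data.hyps(1) h1h] 2 by simp
      moreover have "dom (M1(l \<mapsto> r)) \<subseteq> dom M \<union> data_cells h1 (Ptr l)" using m(5) cells by auto
      moreover have "prefix h h3" using m(2) r(2) by (rule prefix_order.trans)
      moreover have "X \<subseteq> X1 \<union> N'" using m(3) by blast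
      moreover note \<open>good N (S \<union> (X1 \<union> N')) h3 A r Opaque\<close>
      ultimately show ?thesis unfolding 2(1) functor_ty.simps by blast
    qed
  qed
next
  case (v_safe_data l j v)
  then show ?case by (cases s) auto
next
  case (v_pair l u v B C)
  then obtain s1 s2 where s: "s = SigProd s1 s2" "B = functor_ty s1 (Data i)" "C = functor_ty s2 (Data i)"
    by (cases s) auto
  have cells: "data_cells h1 (Ptr l) = data_cells h1 u \<union> data_cells h1 v"
    using v_pair.hyps(1) by (rule data_cells_simps)
  obtain w1 M1 h2 X1 where 1: "map_eval D g i s1 M h u w1 M1 h2" "prefix h h2" "X \<subseteq> X1"
    "memo_inv h1 N S A (poly_val h0 \<theta>0 q') M1 h2 X1" "dom M1 \<subseteq> dom M \<union> data_cells h1 u"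
    "good N (S \<union> X1) h2 (functor_ty s1 A) w1 Opaque"
    using v_pair.IH(1)[OF _ s(2) v_pair.prems(3)] v_pair.prems(1) cells by auto
  obtain w2 M2 h3 X2 where 2: "map_eval D g i s2 M1 h2 v w2 M2 h3" "prefix h2 h3" "X1 \<subseteq> X2"
    "memo_inv h1 N S A (poly_val h0 \<theta>0 q') M2 h3 X2" "dom M2 \<subseteq> dom M1 \<union> data_cells h1 v"
    "good N (S \<union> X2) h3 (functor_ty s2 A) w2 Opaque"
    using v_pair.IH(2)[OF _ s(3) 1(4)] v_pair.prems(1) cells by auto
  let ?h = "h3 @ [PairCell w1 w2]"
  have ext: "prefix h3 ?h" by simp
  have "good N (S \<union> X2) ?h (functor_ty s1 A) w1 Opaque"
    using good_mono[OF 1(6) subset_refl] 1 2 ext by (meson Un_mono prefix_order.trans subset_refl)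
  moreover have "good N (S \<union> X2) ?h (functor_ty s2 A) w2 Opaque"
    using good_mono[OF 2(6) subset_refl subset_refl ext] .
  ultimately have "good N (S \<union> X2) ?h (functor_ty s A) (Ptr (length h3)) Opaque"
    using A by (auto simp: s(1) cell_at_def ground_functor_ty safe_ground_imp_ground)
  moreover have "map_eval D g i s M h (Ptr l) (Ptr (length h3)) M2 ?h"
    unfolding s(1) using cell_at_prefix[OF v_pair.hyps(1) memo_invD(1)[OF v_pair.prems(3)]] 1(1) 2(1)
    by (rule m_prod)
  moreover have "prefix h ?h" using 1(2) 2(2) ext prefix_order.trans by blast
  moreover have "X \<subseteq> X2" using 1(3) 2(3) by blast
  moreover have "dom M2 \<subseteq> dom M \<union> data_cells h1 (Ptr l)" using 1(5) 2(5) cells by blast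
  moreover note memo_inv_prefix[OF 2(4) ext]
  ultimately show ?case by blast
next
  case (v_inl l v B C)
  then obtain s1 s2 where s: "s = SigSum s1 s2" "B = functor_ty s1 (Data i)"
    by (cases s) auto
  have cells: "data_cells h1 (Ptr l) = data_cells h1 v"
    using v_inl.hyps(1) by (rule data_cells_simps)
  obtain w M1 h2 X1 where 1: "map_eval D g i s1 M h v w M1 h2" "prefix h h2" "X \<subseteq> X1"
    "memo_inv h1 N S A (poly_val h0 \<theta>0 q') M1 h2 X1" "dom M1 \<subseteq> dom M \<union> data_cells h1 v"
    "good N (S \<union> X1) h2 (functor_ty s1 A) w Opaque"
    using v_inl.IH[OF _ s(2) v_inl.prems(3)] v_inl.prems(1) cells by auto
  let ?h = "h2 @ [InlCell w]"
  have ext: "prefix h2 ?h" by simp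
  have "good N (S \<union> X1) ?h (functor_ty s A) (Ptr (length h2)) Opaque"
    using A good_mono[OF 1(6) subset_refl subset_refl ext]
    by (auto simp: s(1) cell_at_def ground_functor_ty safe_ground_imp_ground)
  moreover have "map_eval D g i s M h (Ptr l) (Ptr (length h2)) M1 ?h"
    unfolding s(1) using cell_at_prefix[OF v_inl.hyps(1) memo_invD(1)[OF v_inl.prems(3)]] 1(1)
    by (rule m_inl)
  moreover have "prefix h ?h" using 1(2) ext prefix_order.trans by blast
  moreover have "dom M1 \<subseteq> dom M \<union> data_cells h1 (Ptr l)" using 1(5) cells by simp
  moreover note memo_inv_prefix[OF 1(4) ext] 1(3)
  ultimately show ?case by blast
next
  case (v_inr l v C B)
  then obtain s1 s2 where s: "s = SigSum s1 s2" "C = functor_ty s2 (Data i)"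
    by (cases s) auto
  have cells: "data_cells h1 (Ptr l) = data_cells h1 v"
    using v_inr.hyps(1) by (rule data_cells_simps)
  obtain w M1 h2 X1 where 1: "map_eval D g i s2 M h v w M1 h2" "prefix h h2" "X \<subseteq> X1"
    "memo_inv h1 N S A (poly_val h0 \<theta>0 q') M1 h2 X1" "dom M1 \<subseteq> dom M \<union> data_cells h1 v"
    "good N (S \<union> X1) h2 (functor_ty s2 A) w Opaque"
    using v_inr.IH[OF _ s(2) v_inr.prems(3)] v_inr.prems(1) cells by auto
  let ?h = "h2 @ [InrCell w]"
  have ext: "prefix h2 ?h" by simp
  have "good N (S \<union> X1) ?h (functor_ty s A) (Ptr (length h2)) Opaque"
    using A good_mono[OF 1(6) subset_refl subset_refl ext]
    by (auto simp: s(1) cell_at_def ground_functor_ty safe_ground_imp_ground)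
  moreover have "map_eval D g i s M h (Ptr l) (Ptr (length h2)) M1 ?h"
    unfolding s(1) using cell_at_prefix[OF v_inr.hyps(1) memo_invD(1)[OF v_inr.prems(3)]] 1(1)
    by (rule m_inr)
  moreover have "prefix h ?h" using 1(2) ext prefix_order.trans by blast
  moreover have "dom M1 \<subseteq> dom M \<union> data_cells h1 (Ptr l)" using 1(5) cells by simp
  moreover note memo_inv_prefix[OF 1(4) ext] 1(3)
  ultimately show ?case by blast
qed

text \<open>Starting from an empty table, at most \<open>card N \<le> q\<close> cells get memoized,
  each adding at most \<open>q'\<close> cells. Only afterwards are these moved to \<open>N\<close>,
  which gives \<open>q + q * q'\<close>.\<close>

lemma fold_eval_good:
  assumes g: "good N S h (Arrow (functor_ty (D ! i) A) A) g a"
    and N: "finite N" "card N \<le> poly_val h0 \<theta>0 q"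
    and step: "size_app a Opaque q q' b"
    and A: "safe_ground A"
    and v: "good N S h (Data i) v c"
  shows "\<exists>r M h' N'. fold_eval D g i Map.empty h v r M h' \<and> prefix h h' \<and> N \<subseteq> N' \<and> finite N' \<and>
    card N' \<le> poly_val h0 \<theta>0 (PAdd q (PMul q q')) \<and> good N' S h' A r Opaque"
proof -
  have "memo_inv h N S A (poly_val h0 \<theta>0 q') Map.empty h {}"
    by (simp add: memo_inv_def)
  moreover have "val_ty D h v (Data i)" "data_cells h v \<subseteq> N" using v by auto
  ultimately obtain r M h' X where r: "map_eval D g i Rec Map.empty h v r M h'" "prefix h h'"
      "memo_inv h N S A (poly_val h0 \<theta>0 q') M h' X" "good N (S \<union> X) h' A r Opaque"
    using map_eval_good[OF g N step A, of v "Data i" Rec Map.empty h "{}"]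
    unfolding functor_ty.simps by blast
  note inv = memo_invD[OF r(3)]
  have "card (dom M) \<le> poly_val h0 \<theta>0 q"
    using card_mono[OF N(1) inv(2)] N(2) by simp
  then have "card X \<le> poly_val h0 \<theta>0 q * poly_val h0 \<theta>0 q'"
    using inv(4) by (meson le_trans mult_le_mono1)
  then have "card (N \<union> X) \<le> poly_val h0 \<theta>0 (PAdd q (PMul q q'))"
    using card_Un_le[of N X] N(2) by simp
  moreover have "good (N \<union> X) S h' A r Opaque"
    using r(4) by (auto simp: good_safe_iff[OF A])
  moreover have "fold_eval D g i Map.empty h v r M h'"
    using r(1) by (rule eval_cases(20))
  ultimately show ?thesis using r(2) N(1) inv(3) by (meson Un_upper1 finite_Un)
qed

section \<open>The fundamental lemma\<close>

text \<open>Only the variables in \<open>X\<close>, in practice the free ones, are constrained: for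
  a lowered term, relatedness with empty safe part is known for these alone.\<close>

definition good_env :: "nat set \<Rightarrow> nat set \<Rightarrow> heap \<Rightarrow> nat set \<Rightarrow> ctx \<Rightarrow> env \<Rightarrow> aenv \<Rightarrow> bool" where
  "good_env N S h X \<Gamma> \<theta> \<rho> \<longleftrightarrow> (\<forall>x B. x \<in> X \<longrightarrow> map_of \<Gamma> x = Some B \<longrightarrow>
    (\<exists>v a. map_of \<theta> x = Some v \<and> map_of \<rho> x = Some a \<and> good N S h B v a))"

text \<open>\<open>R\<close> stands for evaluation of a term or application of a value, so that both
  share one form of conclusion.\<close>

definition good_run :: "(val \<Rightarrow> heap \<Rightarrow> bool) \<Rightarrow> nat set \<Rightarrow> nat set \<Rightarrow> heap \<Rightarrow> ty \<Rightarrow> npoly \<Rightarrow> aval \<Rightarrow>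
    bool" where
  "good_run R N S h A q a \<longleftrightarrow> (\<exists>v h' N'. R v h' \<and> prefix h h' \<and> N \<subseteq> N' \<and> finite N' \<and>
    card N' \<le> poly_val h0 \<theta>0 q \<and> good N' S h' A v a)"

lemma good_runI:
  "R v h' \<Longrightarrow> prefix h h' \<Longrightarrow> N \<subseteq> N' \<Longrightarrow> finite N' \<Longrightarrow> card N' \<le> poly_val h0 \<theta>0 q \<Longrightarrow>
    good N' S h' A v a \<Longrightarrow> good_run R N S h A q a"
  unfolding good_run_def by blast

lemmas eval_runI = good_runI[where R = "eval D h \<theta> e" and h = h for h \<theta> e]
lemmas app_runI = good_runI[where R = "app_eval D h u w" and h = h for h u w]

lemma good_runE:
  assumes "good_run R N S h A q a"
  obtains v h' N' where "R v h'" "prefix h h'" "N \<subseteq> N'" "finite N'" "card N' \<le> poly_val h0 \<theta>0 q"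
    "good N' S h' A v a"
  using assms unfolding good_run_def by blast

lemma good_ArrowI:
  assumes "\<And>N' S' h' u b q q' r. N \<subseteq> N' \<Longrightarrow> S \<subseteq> S' \<Longrightarrow> prefix h h' \<Longrightarrow> finite N' \<Longrightarrow>
      card N' \<le> poly_val h0 \<theta>0 q \<Longrightarrow> good N' S' h' A u b \<Longrightarrow> size_app a b q q' r \<Longrightarrow>
      good_run (app_eval D h' v u) N' S' h' B q' r"
  shows "good N S h (Arrow A B) v a"
  unfolding good.simps using assms unfolding good_run_def by blast

lemma good_env_mono:
  assumes "good_env N S h X \<Gamma> \<theta> \<rho>" "Y \<subseteq> X" "N \<subseteq> N'" "S \<subseteq> S'" "prefix h h'"
  shows "good_env N' S' h' Y \<Gamma> \<theta> \<rho>"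
  unfolding good_env_def
proof (intro allI impI)
  fix x B assume "x \<in> Y" "map_of \<Gamma> x = Some B"
  then obtain v a where va: "map_of \<theta> x = Some v" "map_of \<rho> x = Some a" "good N S h B v a"
    using assms(1,2) unfolding good_env_def by blast
  then show "\<exists>v a. map_of \<theta> x = Some v \<and> map_of \<rho> x = Some a \<and> good N' S' h' B v a"
    using good_mono[OF va(3) assms(3-5)] by blast
qed

lemma good_env_Cons:
  assumes "good_env N S h (X - {x}) \<Gamma> \<theta> \<rho>" "good N S h A v a"
  shows "good_env N S h X ((x, A) # \<Gamma>) ((x, v) # \<theta>) ((x, a) # \<rho>)"
  using assms unfolding good_env_def by auto

lemma good_app:
  assumes "good N S h (Arrow A B) v a" "N \<subseteq> N'" "prefix h h'" "finite N'"
    "card N' \<le> poly_val h0 \<theta>0 q" "good N' S h' A u b" "size_app a b q q' r"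
  shows "good_run (app_eval D h' v u) N' S h' B q' r"
  unfolding good_run_def using good_ArrowD[OF assms(1,2) subset_refl assms(3-)] .

text \<open>The disjunction treats normal and safe constructors together, as they build the same
  cell. Even a safe constructor puts its new cell into \<open>N\<close>, where the added
  \<open>PConst 1\<close> accounts for it.\<close>

lemma good_VCon:
  assumes "i < length D" and C: "C = functor_ty (D ! i) (Data i) \<and> E = Data i \<or>
    C = under (functor_ty (D ! i) (Data i)) \<and> E = SafeData i"
  shows "good N S h (Arrow C E) (VCon i) ACon"
proof (rule good_ArrowI)
  fix N' S' h' u b q q' r
  assume *: "finite N'" "card N' \<le> poly_val h0 \<theta>0 q" "good N' S' h' C u b" "size_app ACon b q q' r"
  let ?h = "h' @ [DataCell i u]" and ?N = "insert (length h') N'"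
  have ext: "prefix h' ?h" by simp
  have cell: "cell_at ?h (length h') (DataCell i u)" by (simp add: cell_at_def)
  have normal: "normal_ground (functor_ty (D ! i) (Data i))" by (simp add: normal_functor_ty)
  have u: "val_ty D h' u C" "data_cells h' u \<subseteq> N' \<union> S'"
    "E = Data i \<Longrightarrow> data_cells h' u \<subseteq> N'"
    using C *(3) good_normal_iff[OF normal] good_under_iff[OF normal] by auto
  have "val_ty D ?h (Ptr (length h')) E"
    using C val_ty_prefix[OF u(1) ext] cell assms(1) by (auto intro: v_data v_safe_data)
  moreover have "data_cells ?h (Ptr (length h')) = insert (length h') (data_cells h' u)"
    using data_cells_simps(1)[OF cell] data_cells_prefix[OF u(1) ext] by simp
  ultimately have "good ?N S' ?h E (Ptr (length h')) Opaque"
    using C u(2,3) by auto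
  moreover have "card ?N \<le> poly_val h0 \<theta>0 (PAdd q (PConst 1))"
    using *(1,2) by (simp add: card_insert_if)
  moreover have "q' = PAdd q (PConst 1)" "r = Opaque" using *(4) by (auto elim: size_app_cases)
  ultimately show "good_run (app_eval D h' (VCon i) u) N' S' h' E q' r"
    using app_runI[where N' = ?N, OF a_con ext] *(1) by blast
qed

lemma good_VDes:
  assumes C: "C = functor_ty (D ! i) (Data i) \<and> E = Data i \<or>
    C = under (functor_ty (D ! i) (Data i)) \<and> E = SafeData i"
  shows "good N S h (Arrow E C) (VDes i) ADes"
proof (rule good_ArrowI)
  fix N' S' h' u b q q' r
  assume *: "finite N'" "card N' \<le> poly_val h0 \<theta>0 q" "good N' S' h' E u b" "size_app ADes b q q' r"
  have normal: "normal_ground (functor_ty (D ! i) (Data i))" by (simp add: normal_functor_ty)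
  have u: "val_ty D h' u E" "data_cells h' u \<subseteq> N' \<union> S'"
    "E = Data i \<Longrightarrow> data_cells h' u \<subseteq> N'" using C *(3) by auto
  obtain l v where v: "u = Ptr l" "cell_at h' l (DataCell i v)" "val_ty D h' v C"
    using C u(1) by (auto elim: val_ty_cases)
  then have "data_cells h' v \<subseteq> N' \<union> S'" "E = Data i \<Longrightarrow> data_cells h' v \<subseteq> N'"
    using u(2,3) data_cells_simps(1)[OF v(2)] by auto
  then have "good N' S' h' C v Opaque"
    using C v(3) good_normal_iff[OF normal] good_under_iff[OF normal] by auto
  moreover have "q' = q" "r = Opaque" using *(4) by (auto elim: size_app_cases)
  ultimately show "good_run (app_eval D h' (VDes i) u) N' S' h' C q' r"
    using app_runI[OF a_des[OF v(2)] prefix_order.refl subset_refl] *(1,2) v(1) by blast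
qed

text \<open>Fundamental lemma of the relation; it also yields termination. \<open>S\<close> is
  arbitrary in the induction because the lower rule switches to the empty set.\<close>

lemma eval_good:
  assumes "typing D \<Gamma> e A" "good_env N S h (fv e) \<Gamma> \<theta> \<rho>" "finite N"
    "card N \<le> poly_val h0 \<theta>0 q" "size_eval \<rho> e q q' a"
  shows "good_run (eval D h \<theta> e) N S h A q' a"
  using assms
proof (induction arbitrary: N S h \<theta> \<rho> q q' a rule: typing.induct)
  case (t_var \<Gamma> x A)
  have "map_of \<rho> x = Some a" "q' = q" using t_var.prems(4) by (auto elim: size_eval_cases)
  then obtain v where "map_of \<theta> x = Some v" "good N S h A v a"
    using t_var by (auto simp: good_env_def)
  then show ?case
    using eval_runI[OF e_var prefix_order.refl subset_refl t_var.prems(2)] t_var.prems(3) \<open>q' = q\<close>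
    by blast
next
  case (t_app \<Gamma> e A B f)
  obtain q1 q2 b c where s: "size_eval \<rho> e q q1 b" "size_eval \<rho> f q1 q2 c" "size_app b c q2 q' a"
    using t_app.prems(4) by (auto elim: size_eval_cases)
  have envs: "good_env N S h (fv e) \<Gamma> \<theta> \<rho>" "good_env N S h (fv f) \<Gamma> \<theta> \<rho>"
    using good_env_mono[OF t_app.prems(1) _ subset_refl subset_refl prefix_order.refl] by auto
  obtain u h1 N1 where 1: "eval D h \<theta> e u h1" "prefix h h1" "N \<subseteq> N1" "finite N1"
    "card N1 \<le> poly_val h0 \<theta>0 q1" "good N1 S h1 (Arrow A B) u b"
    using good_runE[OF t_app.IH(1)[OF envs(1) t_app.prems(2,3) s(1)]] .
  have "good_env N1 S h1 (fv f) \<Gamma> \<theta> \<rho>"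
    using good_env_mono[OF envs(2) subset_refl 1(3) subset_refl 1(2)] .
  then obtain v h2 N2 where 2: "eval D h1 \<theta> f v h2" "prefix h1 h2" "N1 \<subseteq> N2" "finite N2"
    "card N2 \<le> poly_val h0 \<theta>0 q2" "good N2 S h2 A v c"
    using good_runE[OF t_app.IH(2)[OF _ 1(4,5) s(2)]] by blast
  obtain w h3 N3 where 3: "app_eval D h2 u v w h3" "prefix h2 h3" "N2 \<subseteq> N3" "finite N3"
    "card N3 \<le> poly_val h0 \<theta>0 q'" "good N3 S h3 B w a"
    using good_runE[OF good_app[OF 1(6) 2(3,2,4,5,6) s(3)]] .
  show ?case
    by (rule eval_runI[OF e_app[OF 1(1) 2(1) 3(1)] _ _ 3(4-6)])
      (use 1(2,3) 2(2,3) 3(2,3) in \<open>blast intro: prefix_order.trans\<close>)+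
next
  case (t_lam A x \<Gamma> e B)
  have a: "a = AClo x e \<rho>" "q' = q" using t_lam.prems(4) by (auto elim: size_eval_cases)
  have "good N S h (Arrow A B) (Clo x e \<theta>) a"
  proof (rule good_ArrowI)
    fix N' S' h' u b p p' r
    assume *: "N \<subseteq> N'" "S \<subseteq> S'" "prefix h h'" "finite N'" "card N' \<le> poly_val h0 \<theta>0 p"
      "good N' S' h' A u b" "size_app a b p p' r"
    have s: "size_eval ((x, b) # \<rho>) e p p' r" using *(7) a(1) by (auto elim: size_app_cases)
    have "good_env N' S' h' (fv e - {x}) \<Gamma> \<theta> \<rho>"
      using good_env_mono[OF t_lam.prems(1) _ *(1-3)] by simp
    from good_env_Cons[OF this *(6)]
    obtain w h'' N'' where "eval D h' ((x, u) # \<theta>) e w h''" "prefix h' h''" "N' \<subseteq> N''" "finite N''"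
      "card N'' \<le> poly_val h0 \<theta>0 p'" "good N'' S' h'' B w r"
      using good_runE[OF t_lam.IH[OF _ *(4,5) s]] by blast
    then show "good_run (app_eval D h' (Clo x e \<theta>) u) N' S' h' B p' r"
      by (blast intro: app_runI a_clo)
  qed
  then show ?case
    using eval_runI[OF e_lam prefix_order.refl subset_refl t_lam.prems(2)] t_lam.prems(3) a(2)
    by blast
next
  case (t_triv \<Gamma>)
  have "q' = q" using t_triv.prems(4) by (auto elim: size_eval_cases)
  then show ?case
    using eval_runI[OF e_triv prefix_order.refl subset_refl t_triv.prems(2)] t_triv.prems(3) by simp
next
  case (t_pair \<Gamma> e A f B)
  obtain q1 b c where s: "size_eval \<rho> e q q1 b" "size_eval \<rho> f q1 q' c"
    using t_pair.prems(4) by (auto elim: size_eval_cases)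
  have envs: "good_env N S h (fv e) \<Gamma> \<theta> \<rho>" "good_env N S h (fv f) \<Gamma> \<theta> \<rho>"
    using good_env_mono[OF t_pair.prems(1) _ subset_refl subset_refl prefix_order.refl] by auto
  obtain u h1 N1 where 1: "eval D h \<theta> e u h1" "prefix h h1" "N \<subseteq> N1" "finite N1"
    "card N1 \<le> poly_val h0 \<theta>0 q1" "good N1 S h1 A u b"
    using good_runE[OF t_pair.IH(1)[OF envs(1) t_pair.prems(2,3) s(1)]] .
  have "good_env N1 S h1 (fv f) \<Gamma> \<theta> \<rho>"
    using good_env_mono[OF envs(2) subset_refl 1(3) subset_refl 1(2)] .
  then obtain v h2 N2 where 2: "eval D h1 \<theta> f v h2" "prefix h1 h2" "N1 \<subseteq> N2" "finite N2"
    "card N2 \<le> poly_val h0 \<theta>0 q'" "good N2 S h2 B v c"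
    using good_runE[OF t_pair.IH(2)[OF _ 1(4,5) s(2)]] by blast
  let ?h = "h2 @ [PairCell u v]"
  have ext: "prefix h2 ?h" by simp
  have AB: "ground A" "ground B" using same_kind_ground[OF t_pair.hyps(3)] by auto
  have "good N2 S ?h A u Opaque"
    using good_ground_cong[OF AB(1) good_mono[OF 1(6) 2(3) subset_refl prefix_order.trans[OF 2(2) ext]]] .
  moreover have "good N2 S ?h B v Opaque"
    using good_ground_cong[OF AB(2) good_mono[OF 2(6) subset_refl subset_refl ext]] .
  moreover have "cell_at ?h (length h2) (PairCell u v)" by (simp add: cell_at_def)
  ultimately have "good N2 S ?h (Prod A B) (Ptr (length h2)) a" using AB by auto
  then show ?case
    by (rule eval_runI[OF e_pair[OF 1(1) 2(1)] _ _ 2(4,5), rotated 2])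
      (use 1(2,3) 2(2,3) ext in \<open>blast intro: prefix_order.trans\<close>)+
next
  case (t_fst \<Gamma> e A B)
  obtain b where s: "size_eval \<rho> e q q' b" "a = Opaque"
    using t_fst.prems(4) by (auto elim: size_eval_cases)
  obtain v h1 N1 where 1: "eval D h \<theta> e v h1" "prefix h h1" "N \<subseteq> N1" "finite N1"
    "card N1 \<le> poly_val h0 \<theta>0 q'" "good N1 S h1 (Prod A B) v b"
    using good_runE[OF t_fst.IH[OF t_fst.prems(1)[unfolded fv.simps] t_fst.prems(2,3) s(1)]] .
  then obtain l u w where "v = Ptr l" "cell_at h1 l (PairCell u w)" "good N1 S h1 A u a"
    using s(2) by auto
  then show ?case using eval_runI[OF e_fst _ 1(3-5)] 1(1,2) by blast
next
  case (t_snd \<Gamma> e A B)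
  obtain b where s: "size_eval \<rho> e q q' b" "a = Opaque"
    using t_snd.prems(4) by (auto elim: size_eval_cases)
  obtain v h1 N1 where 1: "eval D h \<theta> e v h1" "prefix h h1" "N \<subseteq> N1" "finite N1"
    "card N1 \<le> poly_val h0 \<theta>0 q'" "good N1 S h1 (Prod A B) v b"
    using good_runE[OF t_snd.IH[OF t_snd.prems(1)[unfolded fv.simps] t_snd.prems(2,3) s(1)]] .
  then obtain l u w where "v = Ptr l" "cell_at h1 l (PairCell u w)" "good N1 S h1 B w a"
    using s(2) by auto
  then show ?case using eval_runI[OF e_snd _ 1(3-5)] 1(1,2) by blast
next
  case (t_inl \<Gamma> e A B)
  obtain b where s: "size_eval \<rho> e q q' b"
    using t_inl.prems(4) by (auto elim: size_eval_cases)
  obtain u h1 N1 where 1: "eval D h \<theta> e u h1" "prefix h h1" "N \<subseteq> N1" "finite N1"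
    "card N1 \<le> poly_val h0 \<theta>0 q'" "good N1 S h1 A u b"
    using good_runE[OF t_inl.IH[OF t_inl.prems(1)[unfolded fv.simps] t_inl.prems(2,3) s]] .
  let ?h = "h1 @ [InlCell u]"
  have ext: "prefix h1 ?h" by simp
  have AB: "ground A" "ground B" using same_kind_ground[OF t_inl.hyps(3)] by auto
  have "good N1 S ?h A u Opaque"
    using good_ground_cong[OF AB(1) good_mono[OF 1(6) subset_refl subset_refl ext]] .
  moreover have "cell_at ?h (length h1) (InlCell u)" by (simp add: cell_at_def)
  ultimately have "good N1 S ?h (Sum A B) (Ptr (length h1)) a" using AB by auto
  then show ?case
    by (rule eval_runI[OF e_inl[OF 1(1)] prefix_order.trans[OF 1(2) ext] 1(3-5)])
next
  case (t_inr \<Gamma> e B A)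
  obtain b where s: "size_eval \<rho> e q q' b"
    using t_inr.prems(4) by (auto elim: size_eval_cases)
  obtain u h1 N1 where 1: "eval D h \<theta> e u h1" "prefix h h1" "N \<subseteq> N1" "finite N1"
    "card N1 \<le> poly_val h0 \<theta>0 q'" "good N1 S h1 B u b"
    using good_runE[OF t_inr.IH[OF t_inr.prems(1)[unfolded fv.simps] t_inr.prems(2,3) s]] .
  let ?h = "h1 @ [InrCell u]"
  have ext: "prefix h1 ?h" by simp
  have AB: "ground A" "ground B" using same_kind_ground[OF t_inr.hyps(3)] by auto
  have "good N1 S ?h B u Opaque"
    using good_ground_cong[OF AB(2) good_mono[OF 1(6) subset_refl subset_refl ext]] .
  moreover have "cell_at ?h (length h1) (InrCell u)" by (simp add: cell_at_def)
  ultimately have "good N1 S ?h (Sum A B) (Ptr (length h1)) a" using AB by auto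
  then show ?case
    by (rule eval_runI[OF e_inr[OF 1(1)] prefix_order.trans[OF 1(2) ext] 1(3-5)])
next
  case (t_case \<Gamma> e A B x f C y g)
  obtain q1 q2 b c d where s: "size_eval \<rho> e q q1 b" "size_eval ((x, Opaque) # \<rho>) f q1 q2 c"
      "size_eval ((y, Opaque) # \<rho>) g q2 q' d" "a = AJoin c d"
    using t_case.prems(4) by (auto elim: size_eval_cases)
  have envs: "good_env N S h (fv e) \<Gamma> \<theta> \<rho>" "good_env N S h (fv f - {x}) \<Gamma> \<theta> \<rho>"
      "good_env N S h (fv g - {y}) \<Gamma> \<theta> \<rho>"
    using good_env_mono[OF t_case.prems(1) _ subset_refl subset_refl prefix_order.refl] by auto
  obtain v h1 N1 where 1: "eval D h \<theta> e v h1" "prefix h h1" "N \<subseteq> N1" "finite N1"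
    "card N1 \<le> poly_val h0 \<theta>0 q1" "good N1 S h1 (Sum A B) v b"
    using good_runE[OF t_case.IH(1)[OF envs(1) t_case.prems(2,3) s(1)]] .
  then consider l u where "v = Ptr l" "cell_at h1 l (InlCell u)" "good N1 S h1 A u Opaque"
    | l u where "v = Ptr l" "cell_at h1 l (InrCell u)" "good N1 S h1 B u Opaque" by auto
  then show ?case
  proof cases
    case (1 l u)
    note v = this
    have "good_env N1 S h1 (fv f) ((x, A) # \<Gamma>) ((x, u) # \<theta>) ((x, Opaque) # \<rho>)"
      by (rule good_env_Cons[OF good_env_mono[OF envs(2) subset_refl _ subset_refl]])
        (use \<open>N \<subseteq> N1\<close> \<open>prefix h h1\<close> v in simp_all)
    then obtain w h2 N2 where 2: "eval D h1 ((x, u) # \<theta>) f w h2" "prefix h1 h2" "N1 \<subseteq> N2"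
      "finite N2" "card N2 \<le> poly_val h0 \<theta>0 q2" "good N2 S h2 C w c"
      using good_runE[OF t_case.IH(2)[OF _ \<open>finite N1\<close> \<open>card N1 \<le> poly_val h0 \<theta>0 q1\<close> s(2)]] by blast
    \<comment> \<open>The left branch ends with bound \<open>q2\<close>; the symbolic run of the
      right branch only raises it to \<open>q'\<close>.\<close>
    have "card N2 \<le> poly_val h0 \<theta>0 q'" using 2(5) size_mono(1)[OF s(3)] by (rule le_trans)
    moreover have "good N2 S h2 C w a" unfolding s(4) using 2(6) by (rule good_AJoin)
    moreover have "N \<subseteq> N2" "prefix h h2"
      using \<open>N \<subseteq> N1\<close> \<open>prefix h h1\<close> 2(2,3) by (blast, blast intro: prefix_order.trans)
    moreover have "eval D h \<theta> (Case e x f y g) w h2"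
      using e_case_inl[OF _ v(2) 2(1)] \<open>eval D h \<theta> e v h1\<close> v(1) by simp
    ultimately show ?thesis using 2(4) by (blast intro: eval_runI)
  next
    case (2 l u)
    note v = this
    \<comment> \<open>Here the left branch is skipped, so the bound \<open>q1\<close> is weakened to
      \<open>q2\<close>, from which the symbolic run of the right branch starts.\<close>
    have q2: "card N1 \<le> poly_val h0 \<theta>0 q2"
      using \<open>card N1 \<le> poly_val h0 \<theta>0 q1\<close> size_mono(1)[OF s(2)] by (rule le_trans)
    have "good_env N1 S h1 (fv g) ((y, B) # \<Gamma>) ((y, u) # \<theta>) ((y, Opaque) # \<rho>)"
      by (rule good_env_Cons[OF good_env_mono[OF envs(3) subset_refl _ subset_refl]])
        (use \<open>N \<subseteq> N1\<close> \<open>prefix h h1\<close> v in simp_all)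
    then obtain w h2 N2 where 2: "eval D h1 ((y, u) # \<theta>) g w h2" "prefix h1 h2" "N1 \<subseteq> N2"
      "finite N2" "card N2 \<le> poly_val h0 \<theta>0 q'" "good N2 S h2 C w d"
      using good_runE[OF t_case.IH(3)[OF _ \<open>finite N1\<close> q2 s(3)]] by blast
    have "good N2 S h2 C w a" unfolding s(4) using 2(6) by (rule good_AJoin)
    moreover have "N \<subseteq> N2" "prefix h h2"
      using \<open>N \<subseteq> N1\<close> \<open>prefix h h1\<close> 2(2,3) by (blast, blast intro: prefix_order.trans)
    moreover have "eval D h \<theta> (Case e x f y g) w h2"
      using e_case_inr[OF _ v(2) 2(1)] \<open>eval D h \<theta> e v h1\<close> v(1) by simp
    ultimately show ?thesis using 2(4,5) by (blast intro: eval_runI)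
  qed
next
  case (t_con i \<Gamma>)
  have "a = ACon" "q' = q" using t_con.prems(4) by (auto elim: size_eval_cases)
  then show ?case
    using eval_runI[OF e_con prefix_order.refl subset_refl t_con.prems(2)] t_con.prems(3)
      good_VCon[OF t_con.hyps] by blast
next
  case (t_des i \<Gamma>)
  have "a = ADes" "q' = q" using t_des.prems(4) by (auto elim: size_eval_cases)
  then show ?case
    using eval_runI[OF e_des prefix_order.refl subset_refl t_des.prems(2)] t_des.prems(3)
      good_VDes by blast
next
  case (t_safe_con i \<Gamma>)
  have "a = ACon" "q' = q" using t_safe_con.prems(4) by (auto elim: size_eval_cases)
  then show ?case
    using eval_runI[OF e_safe_con prefix_order.refl subset_refl t_safe_con.prems(2)]
      t_safe_con.prems(3) good_VCon[OF t_safe_con.hyps] by blast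
next
  case (t_safe_des i \<Gamma>)
  have "a = ADes" "q' = q" using t_safe_des.prems(4) by (auto elim: size_eval_cases)
  then show ?case
    using eval_runI[OF e_safe_des prefix_order.refl subset_refl t_safe_des.prems(2)]
      t_safe_des.prems(3) good_VDes by blast
next
  case (t_fold i A \<Gamma> f e)
  obtain q1 q2 q3 b c d where s: "size_eval \<rho> f q q1 b" "size_eval \<rho> e q1 q2 c"
      "size_app b Opaque q2 q3 d" "q' = PAdd q2 (PMul q2 q3)" "a = Opaque"
    using t_fold.prems(4) by (auto elim: size_eval_cases)
  have envs: "good_env N S h (fv f) \<Gamma> \<theta> \<rho>" "good_env N S h (fv e) \<Gamma> \<theta> \<rho>"
    using good_env_mono[OF t_fold.prems(1) _ subset_refl subset_refl prefix_order.refl] by auto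
  obtain u h1 N1 where 1: "eval D h \<theta> f u h1" "prefix h h1" "N \<subseteq> N1" "finite N1"
    "card N1 \<le> poly_val h0 \<theta>0 q1" "good N1 S h1 (Arrow (functor_ty (D ! i) A) A) u b"
    using good_runE[OF t_fold.IH(1)[OF envs(1) t_fold.prems(2,3) s(1)]] .
  have "good_env N1 S h1 (fv e) \<Gamma> \<theta> \<rho>"
    using good_env_mono[OF envs(2) subset_refl 1(3) subset_refl 1(2)] .
  then obtain v h2 N2 where 2: "eval D h1 \<theta> e v h2" "prefix h1 h2" "N1 \<subseteq> N2" "finite N2"
    "card N2 \<le> poly_val h0 \<theta>0 q2" "good N2 S h2 (Data i) v c"
    using good_runE[OF t_fold.IH(2)[OF _ 1(4,5) s(2)]] by blast
  obtain r M h3 N3 where 3: "fold_eval D u i Map.empty h2 v r M h3" "prefix h2 h3" "N2 \<subseteq> N3"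
    "finite N3" "card N3 \<le> poly_val h0 \<theta>0 q'" "good N3 S h3 A r a"
    using fold_eval_good[OF good_mono[OF 1(6) 2(3) subset_refl 2(2)] 2(4,5) s(3) t_fold.hyps(2) 2(6)]
    unfolding s(4,5) by blast
  show ?case
    by (rule eval_runI[OF e_fold[OF 1(1) 2(1) 3(1)] _ _ 3(4-6)])
      (use 1(2,3) 2(2,3) 3(2,3) in \<open>blast intro: prefix_order.trans\<close>)+
next
  case (t_lower \<Gamma> e A)
  \<comment> \<open>No free variable has a safe type, so by \<open>good_discard_safe\<close> the
    environment is still good with \<open>S = {}\<close>; the cells of the value then lie in
    \<open>N'\<close> alone, as a normal type demands.\<close>
  have "good_env N {} h (fv e) \<Gamma> \<theta> \<rho>"
    unfolding good_env_def
  proof (intro allI impI)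
    fix x B assume x: "x \<in> fv e" "map_of \<Gamma> x = Some B"
    then have "\<not> yields_safe B" using t_lower.hyps(3) by (auto simp: sfv_def safe_type_def)
    moreover obtain v a where "map_of \<theta> x = Some v" "map_of \<rho> x = Some a" "good N S h B v a"
      using t_lower.prems(1) x unfolding good_env_def by blast
    ultimately show "\<exists>v a. map_of \<theta> x = Some v \<and> map_of \<rho> x = Some a \<and> good N {} h B v a"
      using good_discard_safe by blast
  qed
  then obtain v h' N' where 1: "eval D h \<theta> e v h'" "prefix h h'" "N \<subseteq> N'" "finite N'"
    "card N' \<le> poly_val h0 \<theta>0 q'" "good N' {} h' (under A) v a"
    using good_runE[OF t_lower.IH[OF _ t_lower.prems(2-4)]] by blast
  have "val_ty D h' v A" "data_cells h' v \<subseteq> N'"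
    using 1(6) good_under_iff[OF t_lower.hyps(2)] val_ty_under[OF _ t_lower.hyps(2)] by auto
  then have "good N' S h' A v a" using good_normal_iff[OF t_lower.hyps(2)] by blast
  then show ?case by (rule eval_runI[OF 1(1-5)])
qed

end

section \<open>The size bound\<close>

text \<open>The initial polynomial. Types are looked up in the full context \<open>\<Gamma>\<close>
  because of shadowing, while \<open>\<Delta>\<close> is the part still to be traversed; a repeated
  variable is counted again, which an upper bound allows.\<close>

fun normal_sizes :: "ctx \<Rightarrow> ctx \<Rightarrow> npoly" where
  "normal_sizes \<Gamma> [] = PConst 0"
| "normal_sizes \<Gamma> ((x, B) # \<Delta>) =
    (if \<exists>A. map_of \<Gamma> x = Some A \<and> normal_ground A then PAdd (PSize x) (normal_sizes \<Gamma> \<Delta>)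
     else normal_sizes \<Gamma> \<Delta>)"

definition opaque_env :: "ctx \<Rightarrow> aenv" where
  "opaque_env \<Gamma> = map (\<lambda>(x, B). (x, Opaque)) \<Gamma>"

lemma map_of_opaque_env: "map_of (opaque_env \<Gamma>) x = map_option (\<lambda>_. Opaque) (map_of \<Gamma> x)"
  by (induction \<Gamma>) (auto simp: opaque_env_def)

lemma normal_poly_sizes: "normal_poly \<Gamma> (normal_sizes \<Gamma> \<Delta>)"
  by (induction \<Gamma> \<Delta> rule: normal_sizes.induct) (auto simp: normal_poly_def)

lemma apparent_size_eq: "apparent_size h V = card (\<Union>v\<in>V. data_cells h v)"
  unfolding apparent_size_def data_cells_def by (rule arg_cong[of _ _ card]) blast

lemma card_normal_cells:
  "card (\<Union>x\<in>{x \<in> fst ` set \<Delta>. \<exists>A. map_of \<Gamma> x = Some A \<and> normal_ground A}.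
      \<Union>v\<in>{v. map_of \<theta> x = Some v}. data_cells h v) \<le> poly_val h \<theta> (normal_sizes \<Gamma> \<Delta>)"
proof (induction \<Gamma> \<Delta> rule: normal_sizes.induct)
  case (2 \<Gamma> x B \<Delta>)
  let ?C = "\<lambda>x. \<Union>v\<in>{v. map_of \<theta> x = Some v}. data_cells h v"
  let ?X = "\<lambda>\<Delta>. {x \<in> fst ` set \<Delta>. \<exists>A. map_of \<Gamma> x = Some A \<and> normal_ground A}"
  show ?case
  proof (cases "\<exists>A. map_of \<Gamma> x = Some A \<and> normal_ground A")
    case True
    then have "?X ((x, B) # \<Delta>) = insert x (?X \<Delta>)" by auto
    then have "card (\<Union>y\<in>?X ((x, B) # \<Delta>). ?C y) \<le> card (?C x) + card (\<Union>y\<in>?X \<Delta>. ?C y)"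
      by (simp add: card_Un_le)
    also have "card (?C x) = vars_size h \<theta> {x}" by (simp add: vars_size_def apparent_size_eq)
    finally show ?thesis using True 2(1) by simp
  next
    case False
    then have "?X ((x, B) # \<Delta>) = ?X \<Delta>" by auto
    then show ?thesis using False 2 by auto
  qed
qed simp

text \<open>Instance of \<open>eval_good\<close> in which \<open>N\<close> and \<open>S\<close> are
  the cells of the normal inputs and of the safe free variables, and polynomials are read at the
  given heap and environment.\<close>

lemma size_bound:
  assumes ty: "typing D \<Gamma> e \<tau>" "ground \<tau>" and env: "env_for D h \<Gamma> \<theta>"
    and s: "size_eval (opaque_env \<Gamma>) e (normal_sizes \<Gamma> \<Gamma>) p a"
  shows "\<exists>v h'. eval D h \<theta> e v h' \<and> apparent_size h' {v} \<le> poly_val h \<theta> p + vars_size h \<theta> (sfv \<Gamma> e)"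
proof -
  let ?N = "\<Union>x\<in>{x \<in> fst ` set \<Gamma>. \<exists>A. map_of \<Gamma> x = Some A \<and> normal_ground A}.
      \<Union>v\<in>{v. map_of \<theta> x = Some v}. data_cells h v"
  let ?S = "\<Union>v\<in>{v. \<exists>x\<in>sfv \<Gamma> e. map_of \<theta> x = Some v}. data_cells h v"
  have fin: "finite ?N"
    by (rule finite_subset[of _ "{..<length h}"]) (auto simp: data_cells_def dest: reach_bound)
  have "good_env D h \<theta> ?N ?S h (fv e) \<Gamma> \<theta> (opaque_env \<Gamma>)"
    unfolding good_env_def
  proof (intro allI impI)
    fix x B assume x: "x \<in> fv e" "map_of \<Gamma> x = Some B"
    then obtain v where v: "map_of \<theta> x = Some v" "val_ty D h v B"
      using env by (auto simp: env_for_def)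
    have "good D h \<theta> ?N ?S h B v Opaque"
      using val_ty_kind[OF v(2)]
    proof
      assume B: "normal_ground B"
      moreover have "x \<in> fst ` set \<Gamma>" using x(2) by (force dest: map_of_SomeD)
      ultimately have "data_cells h v \<subseteq> ?N" using x v(1) by auto
      then show ?thesis using v(2) good_normal_iff[OF B] by blast
    next
      assume B: "safe_ground B"
      then have "x \<in> sfv \<Gamma> e" using x by (auto simp: sfv_def safe_type_def)
      then have "data_cells h v \<subseteq> ?N \<union> ?S" using v(1) by auto
      then show ?thesis using v(2) good_safe_iff[OF B] by blast
    qed
    then show "\<exists>v a. map_of \<theta> x = Some v \<and> map_of (opaque_env \<Gamma>) x = Some a \<and>
        good D h \<theta> ?N ?S h B v a"
      using v(1) x(2) by (auto simp: map_of_opaque_env)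
  qed
  from eval_good[OF ty(1) this fin card_normal_cells s]
  obtain v h' N' where r: "eval D h \<theta> e v h'" "prefix h h'" "?N \<subseteq> N'" "finite N'"
      "card N' \<le> poly_val h \<theta> p" "good D h \<theta> N' ?S h' \<tau> v a"
    by (rule good_runE)
  have "finite ?S"
    by (rule finite_subset[of _ "{..<length h}"]) (auto simp: data_cells_def dest: reach_bound)
  then have "finite (N' \<union> ?S)" using r(4) by (rule finite_UnI[rotated])
  \<comment> \<open>\<open>S\<close> has not changed during the evaluation, so the safe inputs are
    added just once, outside the polynomial.\<close>
  then have "card (data_cells h' v) \<le> card (N' \<union> ?S)"
    using good_data_cells[OF ty(2) r(6)] by (rule card_mono)
  also have "\<dots> \<le> card N' + card ?S" by (rule card_Un_le)
  finally show ?thesis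
    using r(1,5) by (intro exI[of _ v] exI[of _ h']) (simp add: apparent_size_eq vars_size_def)
qed

lemma opaque_env_halts:
  assumes "typing D \<Gamma> e \<tau>" "ground_ctx \<Gamma>"
  shows "\<exists>p a. size_eval (opaque_env \<Gamma>) e q p a"
proof -
  have "\<exists>a. map_of (opaque_env \<Gamma>) x = Some a \<and> halting B a" if "map_of \<Gamma> x = Some B" for x B
    using that assms(2) by (auto simp: map_of_opaque_env ground_ctx_def intro: halting_ground)
  then show ?thesis using size_eval_halts[OF assms(1)] by blast
qed

section \<open>A program computing the bound\<close>

inductive_cases run_cases:
  "run P x Arg r"
  "run P x RLeaf r"
  "run P x (RNode a b) r"
  "run P x (RLeft a) r"
  "run P x (RRight a) r"
  "run P x (RIf a b c) r"
  "run P x (Call k a) r"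

lemma run_deterministic: "run P x a s \<Longrightarrow> run P x a t \<Longrightarrow> t = s"
proof (induction arbitrary: t rule: run.induct)
  case (r_call k x a s r)
  then show ?case by (blast elim: run_cases)
qed (blast elim: run_cases | fastforce elim: run_cases)+

lemma run_simps:
  "run P x Arg r \<longleftrightarrow> r = x"
  "run P x RLeaf r \<longleftrightarrow> r = Leaf"
  "run P x (RNode a b) r \<longleftrightarrow> (\<exists>s. run P x a s \<and> (\<exists>t. run P x b t \<and> r = Node s t))"
  "run P x (RLeft a) r \<longleftrightarrow> (\<exists>t. run P x a (Node r t))"
  "run P x (RRight a) r \<longleftrightarrow> (\<exists>s. run P x a (Node s r))"
  by (auto intro: run.intros elim: run_cases)

lemma run_RIf:
  "run P x (RIf a b c) r \<longleftrightarrow>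
    (\<exists>s. run P x a s \<and> (case s of Leaf \<Rightarrow> run P x c r | Node _ _ \<Rightarrow> run P x b r))"
proof
  assume "\<exists>s. run P x a s \<and> (case s of Leaf \<Rightarrow> run P x c r | Node _ _ \<Rightarrow> run P x b r)"
  then obtain s where "run P x a s" "case s of Leaf \<Rightarrow> run P x c r | Node _ _ \<Rightarrow> run P x b r" by blast
  then show "run P x (RIf a b c) r" by (cases s) (auto intro: r_if_leaf r_if_node)
qed (force elim: run_cases)

text \<open>Case distinction on a unary tag: every \<open>RRight\<close> strips one successor, and
  the position in the list is the tag.\<close>

fun switch :: "rexp \<Rightarrow> rexp list \<Rightarrow> rexp" where
  "switch n [] = RLeaf"
| "switch n (b # bs) = RIf n (switch (RRight n) bs) b"

lemma run_switch:
  "run P x n (enc_nat k) \<Longrightarrow> k < length bs \<Longrightarrow> run P x (bs ! k) r \<Longrightarrow> run P x (switch n bs) r"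
proof (induction bs arbitrary: n k)
  case (Cons b bs)
  then show ?case
    by (cases k) (auto intro: r_if_leaf r_if_node r_right)
qed simp

fun rnat :: "nat \<Rightarrow> rexp" where
  "rnat 0 = RLeaf"
| "rnat (Suc k) = RNode RLeaf (rnat k)"

lemma run_rnat [simp]: "run P x (rnat k) r \<longleftrightarrow> r = enc_nat k"
  by (induction k arbitrary: r) (auto simp: run_simps)

fun rlist :: "rexp list \<Rightarrow> rexp" where
  "rlist [] = RLeaf"
| "rlist (a # as) = RNode a (rlist as)"

definition rtag :: "nat \<Rightarrow> rexp list \<Rightarrow> rexp" where
  "rtag k as = RNode (rnat k) (rlist as)"

text \<open>\<open>Suc i\<close> because the first \<open>RRight\<close> passes from the tag to the
  argument list.\<close>

definition rarg :: "nat \<Rightarrow> rexp \<Rightarrow> rexp" where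
  "rarg i a = RLeft ((RRight ^^ Suc i) a)"

function enc_aval :: "aval \<Rightarrow> tree" where
  "enc_aval Opaque = tagged 0 []"
| "enc_aval (AClo x e \<rho>) = tagged 1 [enc_nat x, enc_tm e,
    enc_list (map (\<lambda>p. Node (enc_nat (fst p)) (enc_aval (snd p))) \<rho>)]"
| "enc_aval ACon = tagged 2 []"
| "enc_aval ADes = tagged 3 []"
| "enc_aval (AJoin a b) = tagged 4 [enc_aval a, enc_aval b]"
  by pat_completeness auto
termination
proof (relation "measure size", goal_cases)
  case (2 x e \<rho> p)
  \<comment> \<open>The size of an environment entry is counted in the size of the list, which is a
    summand of the size of the closure.\<close>
  then have "size (snd p) < Suc (size_list (size_prod (\<lambda>_. 0) size) \<rho>)"
    by (induction \<rho>) auto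
  then show ?case by simp
qed auto

text \<open>Contexts and abstract environments share this format, so one lookup function serves
  both.\<close>

definition enc_assoc :: "('a \<Rightarrow> tree) \<Rightarrow> (nat \<times> 'a) list \<Rightarrow> tree" where
  "enc_assoc f xs = enc_list (map (\<lambda>p. Node (enc_nat (fst p)) (f (snd p))) xs)"

lemma enc_assoc_simps [simp]:
  "enc_assoc f [] = Leaf"
  "enc_assoc f ((x, a) # xs) = Node (Node (enc_nat x) (f a)) (enc_assoc f xs)"
  by (simp_all add: enc_assoc_def)

lemma enc_aval_AClo: "enc_aval (AClo x e \<rho>) = tagged 1 [enc_nat x, enc_tm e, enc_assoc enc_aval \<rho>]"
  by (simp add: enc_assoc_def)

declare enc_aval.simps(2) [simp del] enc_aval_AClo [simp]

section \<open>The text of the program\<close>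

text \<open>Call numbers are positions in \<open>size_program\<close>: 0 is the entry point, 1
  equality of numbers, 2 and 3 symbolic evaluation and application, 4 lookup, 5 the test for normal
  ground types, 6 \<open>opaque_env\<close> and 7 \<open>normal_sizes\<close>. Functions 2 and 3
  return a pair of a polynomial and an abstract value.\<close>

definition eval_call :: "rexp \<Rightarrow> rexp \<Rightarrow> rexp \<Rightarrow> rexp" where
  "eval_call r e q = Call 2 (RNode r (RNode e q))"

definition app_call :: "rexp \<Rightarrow> rexp \<Rightarrow> rexp \<Rightarrow> rexp" where
  "app_call a b q = Call 3 (RNode a (RNode b q))"

definition eq_body :: rexp where
  "eq_body = RIf (RLeft Arg)
    (RIf (RRight Arg) (Call 1 (RNode (RRight (RLeft Arg)) (RRight (RRight Arg)))) RLeaf)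
    (RIf (RRight Arg) RLeaf (RNode RLeaf RLeaf))"

definition lookup_body :: rexp where
  "lookup_body = RIf (Call 1 (RNode (RLeft Arg) (RLeft (RLeft (RRight Arg)))))
    (RRight (RLeft (RRight Arg)))
    (Call 4 (RNode (RLeft Arg) (RRight (RRight Arg))))"

definition normal_body :: rexp where
  "normal_body = (let pair = RIf (Call 5 (rarg 0 Arg)) (Call 5 (rarg 1 Arg)) RLeaf in
    switch (RLeft Arg) [RNode RLeaf RLeaf, RNode RLeaf RLeaf, RLeaf, pair, pair, RLeaf])"

definition opaque_body :: rexp where
  "opaque_body = RIf Arg
    (RNode (RNode (RLeft (RLeft Arg)) (rtag 0 [])) (Call 6 (RRight Arg))) RLeaf"

definition sizes_body :: rexp where
  "sizes_body = (let x = RLeft (RLeft (RLeft Arg)); rest = Call 7 (RNode (RRight (RLeft Arg)) (RRight Arg)) in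
    RIf (RLeft Arg) (RIf (Call 5 (Call 4 (RNode x (RRight Arg)))) (rtag 2 [rtag 1 [x], rest]) rest)
      (rtag 0 [RLeaf]))"

text \<open>One body per term constructor, in the order of the tags of \<open>enc_tm\<close>. The
  language has no local binding, so intermediate results such as \<open>r1\<close> are copied as
  expressions and recomputed; only the result matters, not the running time.\<close>

definition eval_bodies :: "rexp list" where
  "eval_bodies = (let \<rho> = RLeft Arg; e = RLeft (RRight Arg); q = RRight (RRight Arg); opq = rtag 0 [];
      r1 = eval_call \<rho> (rarg 0 e) q; r2 = eval_call \<rho> (rarg 1 e) (RLeft r1);
      proj = RNode (RLeft r1) opq;
      bind = (\<lambda>i. RNode (RNode (rarg i e) opq) \<rho>);
      c2 = eval_call (bind 1) (rarg 2 e) (RLeft r1); c3 = eval_call (bind 3) (rarg 4 e) (RLeft c2);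
      f1 = eval_call \<rho> (rarg 1 e) q; f2 = eval_call \<rho> (rarg 2 e) (RLeft f1);
      f3 = app_call (RRight f1) opq (RLeft f2)
    in [RNode q (Call 4 (RNode (rarg 0 e) \<rho>)),
      app_call (RRight r1) (RRight r2) (RLeft r2),
      RNode q (rtag 1 [rarg 0 e, rarg 1 e, \<rho>]),
      RNode q opq,
      RNode (RLeft r2) opq,
      proj, proj, proj, proj,
      RNode (RLeft c3) (rtag 4 [RRight c2, RRight c3]),
      RNode q (rtag 2 []),
      RNode q (rtag 3 []),
      RNode q (rtag 2 []),
      RNode q (rtag 3 []),
      RNode (rtag 2 [RLeft f2, rtag 3 [RLeft f2, RLeft f3]]) opq])"

text \<open>Entry 0 is a placeholder: \<open>size_app\<close> has no rule for
  \<open>Opaque\<close>.\<close>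

definition app_bodies :: "rexp list" where
  "app_bodies = (let a = RLeft Arg; b = RLeft (RRight Arg); q = RRight (RRight Arg); opq = rtag 0 [];
      r1 = app_call (rarg 0 a) b q; r2 = app_call (rarg 1 a) b (RLeft r1)
    in [RLeaf,
      eval_call (RNode (RNode (rarg 0 a) b) (rarg 2 a)) (rarg 1 a) q,
      RNode (rtag 2 [q, rtag 0 [rnat 1]]) opq,
      RNode q opq,
      RNode (RLeft r2) (rtag 4 [RRight r1, RRight r2])])"

definition main_body :: rexp where
  "main_body = (let \<Gamma> = RLeft (RRight Arg) in
    RLeft (eval_call (Call 6 \<Gamma>) (RLeft (RRight (RRight Arg))) (Call 7 (RNode \<Gamma> \<Gamma>))))"

definition size_program :: "rexp list" where
  "size_program = [main_body, eq_body, switch (RLeft (RLeft (RRight Arg))) eval_bodies,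
    switch (RLeft (RLeft Arg)) app_bodies, lookup_body, normal_body, opaque_body, sizes_body]"

text \<open>Keeping the call of a function opaque stops the simplifier from unfolding recursive calls.\<close>

definition calls :: "nat \<Rightarrow> tree \<Rightarrow> tree \<Rightarrow> bool" where
  "calls k s r \<longleftrightarrow> run size_program s (size_program ! k) r"

lemma run_Call:
  "run size_program x (Call k a) r \<longleftrightarrow> k < 8 \<and> (\<exists>s. run size_program x a s \<and> calls k s r)"
  by (auto simp: calls_def size_program_def intro: r_call elim: run_cases)

text \<open>By determinism a known result of a call becomes a rewrite rule, with which the
  simplifier can run the program.\<close>

lemma calls_iff: "calls k s r \<Longrightarrow> calls k s t \<longleftrightarrow> t = r"
  unfolding calls_def using run_deterministic by blast

lemma calls_unfold:
  "calls 0 s r \<longleftrightarrow> run size_program s main_body r"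
  "calls (Suc 0) s r \<longleftrightarrow> run size_program s eq_body r"
  "calls 2 s r \<longleftrightarrow> run size_program s (switch (RLeft (RLeft (RRight Arg))) eval_bodies) r"
  "calls 3 s r \<longleftrightarrow> run size_program s (switch (RLeft (RLeft Arg)) app_bodies) r"
  "calls 4 s r \<longleftrightarrow> run size_program s lookup_body r"
  "calls 5 s r \<longleftrightarrow> run size_program s normal_body r"
  "calls 6 s r \<longleftrightarrow> run size_program s opaque_body r"
  "calls 7 s r \<longleftrightarrow> run size_program s sizes_body r"
  by (simp_all add: calls_def size_program_def)

section \<open>Correctness of the program\<close>

lemma enc_nat_numeral [simp]: "enc_nat (numeral k) = Node Leaf (enc_nat (pred_numeral k))"
  by (simp add: numeral_eq_Suc)

definition enc_bool :: "bool \<Rightarrow> tree" where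
  "enc_bool b = (if b then Node Leaf Leaf else Leaf)"

lemma case_enc_bool [simp]:
  "(case enc_bool b of Leaf \<Rightarrow> f | Node s t \<Rightarrow> g s t) = (if b then g Leaf Leaf else f)"
  by (simp add: enc_bool_def)

lemma funpow_RRight: "RRight ^^ numeral k = RRight \<circ> (RRight ^^ pred_numeral k)"
  by (simp add: numeral_eq_Suc)

lemmas run_program_simps = funpow_RRight
  run_simps run_RIf run_Call tagged_def rtag_def rarg_def eval_call_def app_call_def Let_def

lemma calls_eq: "calls (Suc 0) (Node (enc_nat m) (enc_nat n)) (enc_bool (m = n))"
proof (induction m arbitrary: n)
  case 0
  show ?case unfolding calls_unfold eq_body_def
    by (cases n) (simp_all add: run_program_simps enc_bool_def)
next
  case (Suc m)
  show ?case unfolding calls_unfold eq_body_def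
    by (cases n) (simp_all add: run_program_simps calls_iff[OF Suc.IH], simp add: enc_bool_def)
qed

lemma calls_lookup:
  "map_of xs x = Some a \<Longrightarrow> calls 4 (Node (enc_nat x) (enc_assoc f xs)) (f a)"
proof (induction xs)
  case (Cons p xs)
  obtain y b where p: "p = (y, b)" by (cases p)
  show ?case
  proof (cases "x = y")
    case True
    then show ?thesis using Cons.prems unfolding calls_unfold lookup_body_def p
      by (simp add: run_program_simps calls_iff[OF calls_eq])
  next
    case False
    then have IH: "calls 4 (Node (enc_nat x) (enc_assoc f xs)) (f a)" using Cons p by simp
    show ?thesis unfolding calls_unfold lookup_body_def p
      by (simp add: run_program_simps calls_iff[OF calls_eq] calls_iff[OF IH] False)
  qed
qed simp

lemma calls_normal: "calls 5 (enc_ty A) (enc_bool (normal_ground A))"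
proof (induction A)
  case (Sum A B)
  show ?case unfolding calls_unfold normal_body_def
    by (simp add: run_program_simps calls_iff[OF Sum.IH(1)] calls_iff[OF Sum.IH(2)])
      (simp add: enc_bool_def)
next
  case (Prod A B)
  show ?case unfolding calls_unfold normal_body_def
    by (simp add: run_program_simps calls_iff[OF Prod.IH(1)] calls_iff[OF Prod.IH(2)])
      (simp add: enc_bool_def)
qed (simp_all add: calls_unfold normal_body_def run_program_simps enc_bool_def)

lemma calls_opaque: "calls 6 (enc_assoc enc_ty \<Gamma>) (enc_assoc enc_aval (opaque_env \<Gamma>))"
proof (induction \<Gamma>)
  case Nil
  show ?case unfolding calls_unfold opaque_body_def
    by (simp add: run_program_simps opaque_env_def)
next
  case (Cons p \<Gamma>)
  show ?case unfolding calls_unfold opaque_body_def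
    by (cases p) (simp add: run_program_simps opaque_env_def
      calls_iff[OF Cons[unfolded opaque_env_def]])
qed

text \<open>The inclusion makes each lookup succeed; \<open>lookup_body\<close> gets stuck on a
  missing variable.\<close>

lemma calls_sizes:
  "fst ` set \<Delta> \<subseteq> fst ` set \<Gamma> \<Longrightarrow>
    calls 7 (Node (enc_assoc enc_ty \<Delta>) (enc_assoc enc_ty \<Gamma>)) (enc_poly (normal_sizes \<Gamma> \<Delta>))"
proof (induction \<Delta>)
  case Nil
  show ?case unfolding calls_unfold sizes_body_def by (simp add: run_program_simps)
next
  case (Cons p \<Delta>)
  obtain x B where p: "p = (x, B)" by (cases p)
  then obtain A where A: "map_of \<Gamma> x = Some A"
    using Cons.prems by (metis image_subset_iff fst_conv list.set_intros(1) map_of_eq_None_iff not_Some_eq)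
  have IH: "calls 7 (Node (enc_assoc enc_ty \<Delta>) (enc_assoc enc_ty \<Gamma>)) (enc_poly (normal_sizes \<Gamma> \<Delta>))"
    using Cons by simp
  show ?case unfolding calls_unfold sizes_body_def p
    by (simp add: run_program_simps calls_iff[OF calls_lookup[OF A]] calls_iff[OF calls_normal]
        calls_iff[OF IH] A)
qed

lemma calls_evalI:
  "enc_tm e = tagged k ts \<Longrightarrow> k < 15 \<Longrightarrow>
    run size_program (Node s (Node (enc_tm e) t)) (eval_bodies ! k) r \<Longrightarrow>
    calls 2 (Node s (Node (enc_tm e) t)) r"
  unfolding calls_unfold
  by (rule run_switch) (simp_all add: run_simps tagged_def eval_bodies_def Let_def)

lemma calls_appI:
  "enc_aval a = tagged k ts \<Longrightarrow> k < 5 \<Longrightarrow>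
    run size_program (Node (enc_aval a) t) (app_bodies ! k) r \<Longrightarrow>
    calls 3 (Node (enc_aval a) t) r"
  unfolding calls_unfold
  by (rule run_switch) (simp_all add: run_simps tagged_def app_bodies_def Let_def)

lemmas eval_simps = eval_bodies_def run_program_simps
lemmas app_simps = app_bodies_def run_program_simps

text \<open>Each rule of the symbolic evaluation matches one body, and the induction hypotheses, as
  rewrite rules, give the results of its calls.\<close>

lemma calls_size:
  "size_eval \<rho> e q q' a \<Longrightarrow> calls 2 (Node (enc_assoc enc_aval \<rho>) (Node (enc_tm e) (enc_poly q)))
    (Node (enc_poly q') (enc_aval a))"
  "size_app b c q q' a \<Longrightarrow> calls 3 (Node (enc_aval b) (Node (enc_aval c) (enc_poly q)))
    (Node (enc_poly q') (enc_aval a))"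
proof (induction rule: size_eval_size_app.inducts)
  case (s_var \<rho> x a q)
  show ?case
    by (rule calls_evalI[OF enc_tm.simps(1)])
      (simp_all add: eval_simps calls_iff[OF calls_lookup[OF s_var]])
next
  case (s_app \<rho> e q q1 a f q2 b q3 c)
  note [simp] = s_app.IH[THEN calls_iff]
  show ?case by (rule calls_evalI[OF enc_tm.simps(2)]) (simp_all add: eval_simps)
next
  case (s_lam \<rho> x e q)
  show ?case by (rule calls_evalI[OF enc_tm.simps(3)]) (simp_all add: eval_simps)
next
  case (s_triv \<rho> q)
  show ?case by (rule calls_evalI[OF enc_tm.simps(4)]) (simp_all add: eval_simps)
next
  case (s_pair \<rho> e q q1 a f q2 b)
  note [simp] = s_pair.IH[THEN calls_iff]
  show ?case by (rule calls_evalI[OF enc_tm.simps(5)]) (simp_all add: eval_simps)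
next
  case (s_fst \<rho> e q q1 a)
  note [simp] = s_fst.IH[THEN calls_iff]
  show ?case by (rule calls_evalI[OF enc_tm.simps(6)]) (simp_all add: eval_simps)
next
  case (s_snd \<rho> e q q1 a)
  note [simp] = s_snd.IH[THEN calls_iff]
  show ?case by (rule calls_evalI[OF enc_tm.simps(7)]) (simp_all add: eval_simps)
next
  case (s_inl \<rho> e q q1 a)
  note [simp] = s_inl.IH[THEN calls_iff]
  show ?case by (rule calls_evalI[OF enc_tm.simps(8)]) (simp_all add: eval_simps)
next
  case (s_inr \<rho> e q q1 a)
  note [simp] = s_inr.IH[THEN calls_iff]
  show ?case by (rule calls_evalI[OF enc_tm.simps(9)]) (simp_all add: eval_simps)
next
  case (s_case \<rho> e q q1 a x f q2 b y g q3 c)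
  \<comment> \<open>The hypotheses are brought into the form that the encodings of
    \<open>Opaque\<close> and of extended environments take in the simplified goal.\<close>
  note [simp] = s_case.IH[THEN calls_iff, unfolded enc_assoc_simps enc_aval.simps tagged_def, simplified]
  show ?case by (rule calls_evalI[OF enc_tm.simps(10)]) (simp_all add: eval_simps)
next
  case (s_con \<rho> i q)
  show ?case by (rule calls_evalI[OF enc_tm.simps(11)]) (simp_all add: eval_simps)
next
  case (s_des \<rho> i q)
  show ?case by (rule calls_evalI[OF enc_tm.simps(12)]) (simp_all add: eval_simps)
next
  case (s_safe_con \<rho> i q)
  show ?case by (rule calls_evalI[OF enc_tm.simps(13)]) (simp_all add: eval_simps)
next
  case (s_safe_des \<rho> i q)
  show ?case by (rule calls_evalI[OF enc_tm.simps(14)]) (simp_all add: eval_simps)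
next
  case (s_fold \<rho> f q q1 a e q2 b q3 c i)
  note [simp] = s_fold.IH[THEN calls_iff, unfolded enc_aval.simps tagged_def, simplified]
  show ?case by (rule calls_evalI[OF enc_tm.simps(15)]) (simp_all add: eval_simps)
next
  case (sa_clo x b \<rho> e q q' c)
  note [simp] = sa_clo.IH[THEN calls_iff, unfolded enc_assoc_simps]
  show ?case by (rule calls_appI[OF enc_aval_AClo]) (simp_all add: app_simps)
next
  case (sa_con b q)
  show ?case by (rule calls_appI[OF enc_aval.simps(3)]) (simp_all add: app_simps)
next
  case (sa_des b q)
  show ?case by (rule calls_appI[OF enc_aval.simps(4)]) (simp_all add: app_simps)
next
  case (sa_join a c q q1 r b q2 s)
  note [simp] = sa_join.IH[THEN calls_iff]
  show ?case by (rule calls_appI[OF enc_aval.simps(5)]) (simp_all add: app_simps)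
qed

lemma computes_size_program:
  assumes "size_eval (opaque_env \<Gamma>) e (normal_sizes \<Gamma> \<Gamma>) p a"
  shows "computes size_program (enc_judgment D \<Gamma> e \<tau>) (enc_poly p)"
proof -
  have "enc_list (map (\<lambda>(x, B). Node (enc_nat x) (enc_ty B)) \<Gamma>) = enc_assoc enc_ty \<Gamma>"
    by (simp add: enc_assoc_def split_def)
  then show ?thesis
    unfolding computes_def run_Call calls_unfold main_body_def
    by (simp add: run_program_simps enc_judgment_def calls_iff[OF calls_opaque]
        calls_iff[OF calls_sizes[OF subset_refl]] calls_iff[OF calls_size(1)[OF assms]])
qed

theorem theorem1:
  shows "\<exists>P. \<forall>D \<Gamma> e \<tau>.
    wf_decls D \<and> wf_ctx D \<Gamma> \<and> typing D \<Gamma> e \<tau> \<and> ground \<tau> \<and> ground_ctx \<Gamma> \<longrightarrow>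
    (\<exists>p. computes P (enc_judgment D \<Gamma> e \<tau>) (enc_poly p) \<and> normal_poly \<Gamma> p \<and>
      (\<forall>h \<theta>. env_for D h \<Gamma> \<theta> \<longrightarrow>
        (\<exists>v h'. eval D h \<theta> e v h') \<and>
        (\<forall>v h'. eval D h \<theta> e v h' \<longrightarrow>
          apparent_size h' {v} \<le> poly_val h \<theta> p + vars_size h \<theta> (sfv \<Gamma> e))))"
proof (intro exI[of _ size_program] allI impI, elim conjE)
  fix D \<Gamma> e \<tau>
  assume ty: "typing D \<Gamma> e \<tau>" "ground \<tau>" "ground_ctx \<Gamma>"
  \<comment> \<open>\<open>p\<close> is read off the symbolic evaluation, before any heap or
    environment is given.\<close>
  obtain p a where s: "size_eval (opaque_env \<Gamma>) e (normal_sizes \<Gamma> \<Gamma>) p a"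
    using opaque_env_halts[OF ty(1,3)] by blast
  have "normal_poly \<Gamma> p"
    using normal_poly_sizes size_poly_vars(1)[OF s] unfolding normal_poly_def by blast
  moreover have "(\<exists>v h'. eval D h \<theta> e v h') \<and> (\<forall>v h'. eval D h \<theta> e v h' \<longrightarrow>
      apparent_size h' {v} \<le> poly_val h \<theta> p + vars_size h \<theta> (sfv \<Gamma> e))"
    if "env_for D h \<Gamma> \<theta>" for h \<theta>
    \<comment> \<open>\<open>size_bound\<close> supplies one evaluation within the bound, and
      determinism makes it the only one.\<close>
    using size_bound[OF ty(1,2) that s] eval_deterministic(1) by metis
  ultimately show "\<exists>p. computes size_program (enc_judgment D \<Gamma> e \<tau>) (enc_poly p) \<and> normal_poly \<Gamma> p \<and>
      (\<forall>h \<theta>. env_for D h \<Gamma> \<theta> \<longrightarrow>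
        (\<exists>v h'. eval D h \<theta> e v h') \<and>
        (\<forall>v h'. eval D h \<theta> e v h' \<longrightarrow>
          apparent_size h' {v} \<le> poly_val h \<theta> p + vars_size h \<theta> (sfv \<Gamma> e)))"
    using computes_size_program[OF s] by blast
qed

end
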